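(* Let $n\ge3$. For every automorphism $T\in\mathbb{T}_n^3$ there exists $A\in\mathbb{A}_n^3$ such that $T\circ A$ fixes every corner of the cube $n^3$ and fixes every point of the line $\ell=\{[i,0,0]: i\in[n]\}$.
   Context: Let $[n]=\{0,\dots,n-1\}$; the cube $n^3$ is $[n]^3$. A set of $n$ distinct points is a line if it can be ordered $(q^1,\dots,q^n)$ such that in each coordinate the sequence of values is strictly increasing, strictly decreasing or constant, with at least one coordinate non-constant. $\mathbb{T}_n^3$ is the group of permutations of $[n]^3$ mapping lines onto lines. Composition is written left to right: $(T\circ A)(p)=A(T(p))$. A corner is a point all of whose coordinates lie in $\{0,n-1\}$. $\mathbb{R}$ is the group generated by $R_x([x,y,z])=[x,n-z-1,y]$, $R_y([x,y,z])=[n-z-1,y,x]$, $R_z([x,y,z])=[n-y-1,x,z]$. $\mathbb{F}_n$ is the group of maps $F_\pi([x,y,z])=[\pi(x),\pi(y),\pi(z)]$ for permutations $\pi$ of $[n]$ with $\pi(n-p-1)=n-\pi(p)-1$ for all $p$. $\mathbb{A}_n^3$ is the group generated by $\mathbb{R}\cup\mathbb{F}_n$. *)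

theory Defs
  imports "HOL-Algebra.Bij" "HOL-Algebra.Generated_Groups" "HOL-Combinatorics.Permutations"
begin

type_synonym point = "nat \<times> nat \<times> nat"

definition cube :: "nat \<Rightarrow> point set" where
  "cube n = {..<n} \<times> {..<n} \<times> {..<n}"

definition coords :: "(point \<Rightarrow> nat) set" where
  "coords = {\<lambda>(x, y, z). x, \<lambda>(x, y, z). y, \<lambda>(x, y, z). z}"

definition const_seq :: "nat \<Rightarrow> (nat \<Rightarrow> nat) \<Rightarrow> bool" where
  "const_seq n s \<longleftrightarrow> (\<forall>i<n. \<forall>j<n. s i = s j)"

text \<open>The ordering \<open>(q\<^sup>1, \<dots>, q\<^sup>n)\<close> of the points of a line is indexed from 0, as \<open>q 0, \<dots>, q (n - 1)\<close>.\<close>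

definition is_line :: "nat \<Rightarrow> point set \<Rightarrow> bool" where
  "is_line n L \<longleftrightarrow> L \<subseteq> cube n \<and>
     (\<exists>q. bij_betw q {..<n} L \<and>
          (\<forall>c\<in>coords. strict_mono_on {..<n} (c \<circ> q) \<or>
                       strict_antimono_on {..<n} (c \<circ> q) \<or>
                       const_seq n (c \<circ> q)) \<and>
          (\<exists>c\<in>coords. \<not> const_seq n (c \<circ> q)))"

text \<open>Permutations of the cube are the elements of \<open>BijGroup (cube n)\<close>, i.e. bijections of
  \<open>cube n\<close> that take the value \<open>undefined\<close> outside it.  All groups below are sets of such
  functions. The product in \<open>BijGroup\<close> is right-to-left composition; subgroups and generated
  subgroups do not depend on this choice.\<close>

definition line_autos :: "nat \<Rightarrow> (point \<Rightarrow> point) set" where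
  "line_autos n = {T \<in> carrier (BijGroup (cube n)). \<forall>L. is_line n L \<longrightarrow> is_line n (T ` L)}"

definition corners :: "nat \<Rightarrow> point set" where
  "corners n = {p \<in> cube n. \<forall>c\<in>coords. c p \<in> {0, n - 1}}"

definition rot_x :: "nat \<Rightarrow> point \<Rightarrow> point" where
  "rot_x n = restrict (\<lambda>(x, y, z). (x, n - z - 1, y)) (cube n)"

definition rot_y :: "nat \<Rightarrow> point \<Rightarrow> point" where
  "rot_y n = restrict (\<lambda>(x, y, z). (n - z - 1, y, x)) (cube n)"

definition rot_z :: "nat \<Rightarrow> point \<Rightarrow> point" where
  "rot_z n = restrict (\<lambda>(x, y, z). (n - y - 1, x, z)) (cube n)"

definition rot_group :: "nat \<Rightarrow> (point \<Rightarrow> point) set" where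
  "rot_group n = generate (BijGroup (cube n)) {rot_x n, rot_y n, rot_z n}"

definition perm_map :: "nat \<Rightarrow> (nat \<Rightarrow> nat) \<Rightarrow> point \<Rightarrow> point" where
  "perm_map n \<pi> = restrict (\<lambda>(x, y, z). (\<pi> x, \<pi> y, \<pi> z)) (cube n)"

definition perm_group :: "nat \<Rightarrow> (point \<Rightarrow> point) set" where
  "perm_group n = {perm_map n \<pi> | \<pi>. \<pi> permutes {..<n} \<and> (\<forall>p<n. \<pi> (n - p - 1) = n - \<pi> p - 1)}"

definition std_autos :: "nat \<Rightarrow> (point \<Rightarrow> point) set" where
  "std_autos n = generate (BijGroup (cube n)) (rot_group n \<union> perm_group n)"

definition comp_lr :: "nat \<Rightarrow> (point \<Rightarrow> point) \<Rightarrow> (point \<Rightarrow> point) \<Rightarrow> point \<Rightarrow> point" where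
  "comp_lr n T A = (\<lambda>p\<in>cube n. A (T p))"

lemma rot_in_carrier:
  "rot_x n \<in> carrier (BijGroup (cube n))"
  "rot_y n \<in> carrier (BijGroup (cube n))"
  "rot_z n \<in> carrier (BijGroup (cube n))"
proof -
  have "bij_betw (\<lambda>(x, y, z). (x, n - z - 1, y)) (cube n) (cube n)"
    by (rule bij_betw_byWitness[where f' = "\<lambda>(x, y, z). (x, z, n - y - 1)"]) (auto simp: cube_def)
  then show "rot_x n \<in> carrier (BijGroup (cube n))"
    by (auto simp: rot_x_def BijGroup_def Bij_def cong: bij_betw_cong)
  have "bij_betw (\<lambda>(x, y, z). (n - z - 1, y, x)) (cube n) (cube n)"
    by (rule bij_betw_byWitness[where f' = "\<lambda>(x, y, z). (z, y, n - x - 1)"]) (auto simp: cube_def)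
  then show "rot_y n \<in> carrier (BijGroup (cube n))"
    by (auto simp: rot_y_def BijGroup_def Bij_def cong: bij_betw_cong)
  have "bij_betw (\<lambda>(x, y, z). (n - y - 1, x, z)) (cube n) (cube n)"
    by (rule bij_betw_byWitness[where f' = "\<lambda>(x, y, z). (y, n - x - 1, z)"]) (auto simp: cube_def)
  then show "rot_z n \<in> carrier (BijGroup (cube n))"
    by (auto simp: rot_z_def BijGroup_def Bij_def cong: bij_betw_cong)
qed

lemma rot_group_subset: "rot_group n \<subseteq> carrier (BijGroup (cube n))"
  unfolding rot_group_def
  by (rule group.generate_incl[OF group_BijGroup]) (simp add: rot_in_carrier)

lemma perm_group_subset: "perm_group n \<subseteq> carrier (BijGroup (cube n))"
proof
  fix f assume "f \<in> perm_group n"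
  then obtain \<pi> where f: "f = perm_map n \<pi>" and p: "\<pi> permutes {..<n}"
    by (auto simp: perm_group_def)
  have 1: "\<pi> x < n \<longleftrightarrow> x < n" "inv_into UNIV \<pi> x < n \<longleftrightarrow> x < n" for x
    using permutes_in_image[OF p] permutes_in_image[OF permutes_inv[OF p]] by auto
  have "bij_betw (\<lambda>(x, y, z). (\<pi> x, \<pi> y, \<pi> z)) (cube n) (cube n)"
    by (rule bij_betw_byWitness[where f' = "\<lambda>(x, y, z). (inv_into UNIV \<pi> x, inv_into UNIV \<pi> y, inv_into UNIV \<pi> z)"])
      (auto simp: cube_def 1 permutes_inverses[OF p])
  then show "f \<in> carrier (BijGroup (cube n))"
    by (auto simp: f perm_map_def BijGroup_def Bij_def cong: bij_betw_cong)
qed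

lemma std_autos_subgroup: "subgroup (std_autos n) (BijGroup (cube n))"
  unfolding std_autos_def
  by (rule group.generate_is_subgroup[OF group_BijGroup])
    (use rot_group_subset perm_group_subset in blast)

end

theory Submission
  imports Defs
begin

text \<open>A strictly monotone coordinate of a line runs through \<open>0, \<dots>, n - 1\<close> or its reversal, so a point
  off the main diagonals lies on at most 5 lines and a point on one lies on at least 6. Hence an
  automorphism \<open>T\<close> permutes the main diagonals and fixes their common point, if any, and a standard
  automorphism moves \<open>T(0,0,0)\<close> back to \<open>(0,0,0)\<close>. Then the corners off the diagonal \<open>x = y = z\<close>
  are permuted, antipodes going to antipodes, and collinearity of points next to \<open>(0,0,0)\<close> forces
  the three neighbouring corners to be permuted among themselves; a coordinate permutation makes all
  corners fixed. Now \<open>T(i,0,0) = (\<pi> i,0,0)\<close>, the same \<open>\<pi>\<close> describes \<open>T\<close> on two main diagonals,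
  and collinearity between these shows that \<open>\<pi>\<close> commutes with reversal, so that
  applying \<open>\<pi>\<^sup>-\<^sup>1\<close> in every coordinate finishes the normalisation.\<close>

section \<open>Lines as triples of coordinate sequences\<close>

definition traverses :: "nat \<Rightarrow> (nat \<Rightarrow> nat) \<Rightarrow> bool" where
  "traverses n f \<longleftrightarrow> (\<forall>i<n. f i = i) \<or> (\<forall>i<n. f i = n - Suc i)"

definition stays :: "nat \<Rightarrow> (nat \<Rightarrow> nat) \<Rightarrow> bool" where
  "stays n f \<longleftrightarrow> (\<exists>c<n. \<forall>i<n. f i = c)"

definition line_of :: "nat \<Rightarrow> (nat \<Rightarrow> nat) \<Rightarrow> (nat \<Rightarrow> nat) \<Rightarrow> (nat \<Rightarrow> nat) \<Rightarrow> point set" where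
  "line_of n f g h = (\<lambda>i. (f i, g i, h i)) ` {..<n}"

lemma strict_mono_on_growth:
  fixes f :: "nat \<Rightarrow> nat"
  assumes "strict_mono_on {..<n} f" "i \<le> j" "j < n"
  shows "f i + (j - i) \<le> f j"
  using assms(2,3)
proof (induction j rule: dec_induct)
  case base
  then show ?case by simp
next
  case (step k)
  have "f k < f (Suc k)"
    using assms(1) step.prems by (auto simp: monotone_on_def)
  with step show ?case by simp
qed

text \<open>Growth by at least one per step, counted once from index 0 up to \<open>i\<close> and
  once from \<open>i\<close> up to index \<open>n - 1\<close>, leaves \<open>f i\<close> no value
  but \<open>i\<close>.\<close>

lemma strict_mono_on_lessThan_eq:
  fixes f :: "nat \<Rightarrow> nat"
  assumes "strict_mono_on {..<n} f" "\<forall>i<n. f i < n" "i < n"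
  shows "f i = i"
proof -
  have "f 0 + (i - 0) \<le> f i" "f i + (n - 1 - i) \<le> f (n - 1)" "f (n - 1) < n"
    using strict_mono_on_growth[OF assms(1), of 0 i] strict_mono_on_growth[OF assms(1), of i "n - 1"] assms
    by auto
  with assms(3) show ?thesis by linarith
qed

text \<open>Reflecting the values gives an increasing sequence, to which the previous lemma
  applies.\<close>

lemma strict_antimono_on_lessThan_eq:
  fixes f :: "nat \<Rightarrow> nat"
  assumes "strict_antimono_on {..<n} f" "\<forall>i<n. f i < n" "i < n"
  shows "f i = n - Suc i"
proof -
  have "strict_mono_on {..<n} (\<lambda>i. n - Suc (f i))"
  proof (rule monotone_onI)
    fix i j assume "i \<in> {..<n}" "j \<in> {..<n}" "i < j"
    then have "f j < f i" "f i < n"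
      using monotone_onD[OF assms(1)] assms(2) by auto
    then show "n - Suc (f i) < n - Suc (f j)" by linarith
  qed
  moreover have "\<forall>i<n. n - Suc (f i) < n"
    by auto
  ultimately have "n - Suc (f i) = i"
    using assms(3) by (rule strict_mono_on_lessThan_eq)
  moreover have "f i < n" using assms(2,3) by blast
  ultimately show ?thesis by linarith
qed

lemma traverses_not_const_seq:
  assumes "traverses n f" "2 \<le> n"
  shows "\<not> const_seq n f"
proof
  assume "const_seq n f"
  then have "f 0 = f 1"
    using assms(2) unfolding const_seq_def by (metis Suc_le_lessD One_nat_def less_2_cases_iff order_less_le_trans)
  then show False
    using assms by (auto simp: traverses_def)
qed

lemma monotone_seq_cases:
  assumes "\<forall>i<n. f i < n" "0 < n"
  shows "strict_mono_on {..<n} f \<or> strict_antimono_on {..<n} f \<or> const_seq n f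
    \<longleftrightarrow> traverses n f \<or> stays n f"
proof
  assume "strict_mono_on {..<n} f \<or> strict_antimono_on {..<n} f \<or> const_seq n f"
  then consider "traverses n f" | "const_seq n f"
    using strict_mono_on_lessThan_eq[OF _ assms(1)] strict_antimono_on_lessThan_eq[OF _ assms(1)]
    unfolding traverses_def by blast
  then show "traverses n f \<or> stays n f"
  proof cases
    case 2
    then have "stays n f" using assms unfolding stays_def const_seq_def by blast
    then show ?thesis ..
  qed simp
next
  assume "traverses n f \<or> stays n f"
  then consider "\<forall>i<n. f i = i" | "\<forall>i<n. f i = n - Suc i" | c where "\<forall>i<n. f i = c"
    by (auto simp: traverses_def stays_def)
  then show "strict_mono_on {..<n} f \<or> strict_antimono_on {..<n} f \<or> const_seq n f"
  proof cases
    case 2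
    then have "strict_antimono_on {..<n} f"
      by (simp add: monotone_on_def diff_less_mono2)
    then show ?thesis by blast
  qed (simp_all add: const_seq_def monotone_on_def)
qed

lemma traverses_less: "traverses n f \<Longrightarrow> i < n \<Longrightarrow> f i < n"
  by (auto simp: traverses_def)

lemma stays_less: "stays n f \<Longrightarrow> i < n \<Longrightarrow> f i < n"
  by (auto simp: stays_def)

lemma traverses_inj_on: "traverses n f \<Longrightarrow> inj_on f {..<n}"
  by (auto simp: traverses_def inj_on_def)

text \<open>Trades the ordering of the points for three explicit coordinate sequences, each the
  identity, the reversal or a constant on the indices below \<open>n\<close>. A non-constant
  coordinate becomes a traversing one.\<close>

lemma is_line_iff:
  assumes "2 \<le> n"
  shows "is_line n L \<longleftrightarrow> (\<exists>f g h. L = line_of n f g h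
    \<and> (traverses n f \<or> stays n f) \<and> (traverses n g \<or> stays n g) \<and> (traverses n h \<or> stays n h)
    \<and> (traverses n f \<or> traverses n g \<or> traverses n h))" (is "_ \<longleftrightarrow> ?R")
proof
  assume "is_line n L"
  then obtain q where L: "L \<subseteq> cube n" "bij_betw q {..<n} L"
    and m: "\<forall>c\<in>coords. strict_mono_on {..<n} (c \<circ> q) \<or> strict_antimono_on {..<n} (c \<circ> q) \<or> const_seq n (c \<circ> q)"
    and e: "\<exists>c\<in>coords. \<not> const_seq n (c \<circ> q)"
    by (auto simp: is_line_def)
  have q: "q i \<in> cube n" if "i < n" for i
    using L that by (auto simp: bij_betw_def)
  have 1: "traverses n (c \<circ> q) \<or> stays n (c \<circ> q)" if "c \<in> coords" for c
  proof -
    have "\<forall>i<n. (c \<circ> q) i < n"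
      using q that by (fastforce simp: coords_def cube_def)
    then show ?thesis using monotone_seq_cases[of n "c \<circ> q"] m that assms by simp
  qed
  have 2: "\<exists>c\<in>coords. traverses n (c \<circ> q)"
    using e 1 by (metis (no_types, lifting) const_seq_def stays_def)
  let ?f = "(\<lambda>(x, y, z). x) \<circ> q" and ?g = "(\<lambda>(x, y, z). y) \<circ> q" and ?h = "(\<lambda>(x, y, z). z) \<circ> q"
  have "L = line_of n ?f ?g ?h"
    using L(2) by (force simp: line_of_def bij_betw_def split: prod.splits)
  moreover have "traverses n ?f \<or> stays n ?f" "traverses n ?g \<or> stays n ?g" "traverses n ?h \<or> stays n ?h"
    using 1 by (auto simp: coords_def)
  moreover have "traverses n ?f \<or> traverses n ?g \<or> traverses n ?h"
    using 2 by (auto simp: coords_def)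
  ultimately show ?R by blast
next
  assume ?R
  then obtain f g h where L: "L = line_of n f g h"
    and fgh: "traverses n f \<or> stays n f" "traverses n g \<or> stays n g" "traverses n h \<or> stays n h"
    and t: "traverses n f \<or> traverses n g \<or> traverses n h" by blast
  define q where "q = (\<lambda>i. (f i, g i, h i))"
  have less: "f i < n" "g i < n" "h i < n" if "i < n" for i
    using fgh that traverses_less stays_less by blast+
  have c: "(\<lambda>(x, y, z). x) \<circ> q = f" "(\<lambda>(x, y, z). y) \<circ> q = g" "(\<lambda>(x, y, z). z) \<circ> q = h"
    by (auto simp: q_def)
  \<comment> \<open>A single traversing coordinate already separates the points.\<close>
  have "inj_on q {..<n}"
    using t traverses_inj_on by (fastforce simp: q_def inj_on_def)
  then have "bij_betw q {..<n} L"
    by (simp add: L line_of_def q_def bij_betw_def)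
  moreover have "L \<subseteq> cube n"
    using less by (auto simp: L line_of_def cube_def)
  moreover have "\<forall>c\<in>coords. strict_mono_on {..<n} (c \<circ> q) \<or> strict_antimono_on {..<n} (c \<circ> q) \<or> const_seq n (c \<circ> q)"
    using fgh less monotone_seq_cases[of n] assms by (simp add: coords_def c)
  moreover have "\<exists>c\<in>coords. \<not> const_seq n (c \<circ> q)"
    using t traverses_not_const_seq assms by (auto simp: coords_def c)
  ultimately show "is_line n L"
    unfolding is_line_def by blast
qed

section \<open>Collinearity of two points\<close>

text \<open>\<open>a\<close>, \<open>a'\<close> are the values of one coordinate at two points, and
  \<open>b\<close>, \<open>b'\<close> those of another. On a common line one of the two coordinates
  stays, or they run in equal or in opposite directions.\<close>

definition matches :: "nat \<Rightarrow> nat \<Rightarrow> nat \<Rightarrow> nat \<Rightarrow> nat \<Rightarrow> bool" where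
  "matches n a a' b b' \<longleftrightarrow> a = a' \<or> b = b' \<or> (a = b \<and> a' = b') \<or> (a = n - Suc b \<and> a' = n - Suc b')"

text \<open>For distinct points, \<open>aligned\<close> says that some line contains both.\<close>

fun aligned :: "nat \<Rightarrow> point \<Rightarrow> point \<Rightarrow> bool" where
  "aligned n (x, y, z) (x', y', z') \<longleftrightarrow>
     matches n x x' y y' \<and> matches n x x' z z' \<and> matches n y y' z z'"

lemma step_through:
  assumes "traverses n f \<or> stays n f" "i < n" "j < n" "f i \<noteq> f j"
  shows "traverses n f"
  using assms by (auto simp: stays_def)

lemma steps_match:
  assumes "traverses n f \<or> stays n f" "traverses n g \<or> stays n g" "i < n" "j < n"
  shows "matches n (f i) (f j) (g i) (g j)"
  using assms by (auto simp: stays_def traverses_def matches_def)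

lemma is_line_aligned:
  assumes "2 \<le> n" "is_line n L" "p \<in> L" "q \<in> L"
  shows "aligned n p q"
  using assms by (auto simp: is_line_iff line_of_def intro: steps_match)

text \<open>Because \<open>a \<noteq> a'\<close>, the first coordinate can serve as the parameter of
  a line; the remaining alternatives of \<open>matches\<close> make the second one a constant, the
  identity or the reversal in this parameter.\<close>

lemma step_exists:
  assumes "a < n" "a' < n" "b < n" "b' < n" "a \<noteq> a'" "matches n a a' b b'"
  shows "\<exists>g. (traverses n g \<or> stays n g) \<and> g a = b \<and> g a' = b'"
proof -
  consider "b = b'" | "a = b" "a' = b'" | "a = n - Suc b" "a' = n - Suc b'"
    using assms by (auto simp: matches_def)
  then show ?thesis
  proof cases
    case 1 then show ?thesis using assms by (intro exI[of _ "\<lambda>_. b"]) (auto simp: stays_def)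
  next
    case 2 then show ?thesis using assms by (intro exI[of _ "\<lambda>i. i"]) (auto simp: traverses_def)
  next
    case 3 then show ?thesis using assms by (intro exI[of _ "\<lambda>i. n - Suc i"]) (auto simp: traverses_def)
  qed
qed

text \<open>Below \<open>n\<close> the map \<open>b \<mapsto> n - Suc b\<close> is an involution
  despite truncated subtraction.\<close>

lemma matches_commute: "a < n \<Longrightarrow> a' < n \<Longrightarrow> b < n \<Longrightarrow> b' < n \<Longrightarrow> matches n a a' b b' \<longleftrightarrow> matches n b b' a a'"
  by (auto simp: matches_def)

lemma aligned_is_line:
  assumes "2 \<le> n" "p \<in> cube n" "q \<in> cube n" "p \<noteq> q" "aligned n p q"
  shows "\<exists>L. is_line n L \<and> p \<in> L \<and> q \<in> L"
proof -
  obtain x y z x' y' z' where p: "p = (x, y, z)" and q: "q = (x', y', z')"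
    by (metis surj_pair)
  note lt = assms(2,3)[unfolded p q cube_def, simplified]
  have al: "matches n x x' y y'" "matches n x x' z z'" "matches n y y' z z'"
    using assms(5) by (auto simp: p q)
  note al' = al[THEN matches_commute[THEN iffD1, rotated -1]]
  \<comment> \<open>A coordinate in which the points differ becomes the parameter, with
    \<open>p\<close> at \<open>a\<close> and \<open>q\<close> at \<open>a'\<close>.\<close>
  obtain a a' where a: "a < n" "a' < n" "a \<noteq> a'" "matches n a a' x x'" "matches n a a' y y'" "matches n a a' z z'"
  proof -
    consider "x \<noteq> x'" | "y \<noteq> y'" | "z \<noteq> z'"
      using assms(4) by (auto simp: p q)
    then show thesis
    proof cases
      case 1 then show thesis using that[of x x'] lt al by (auto simp: matches_def)
    next
      case 2 then show thesis using that[of y y'] lt al al' by (auto simp: matches_def)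
    next
      case 3 then show thesis using that[of z z'] lt al al' by (auto simp: matches_def)
    qed
  qed
  obtain f g h where
    fgh: "traverses n f \<or> stays n f" "traverses n g \<or> stays n g" "traverses n h \<or> stays n h"
    and v: "f a = x" "f a' = x'" "g a = y" "g a' = y'" "h a = z" "h a' = z'"
    using step_exists[OF a(1,2) _ _ a(3)] lt a(4-6) by metis
  have "traverses n f \<or> traverses n g \<or> traverses n h"
    using assms(4) step_through[OF fgh(1) a(1,2)] step_through[OF fgh(2) a(1,2)] step_through[OF fgh(3) a(1,2)]
    by (auto simp: p q v)
  then have "is_line n (line_of n f g h)"
    unfolding is_line_iff[OF assms(1)] using fgh by blast
  moreover have "p \<in> line_of n f g h" "q \<in> line_of n f g h"
    using a(1,2) by (force simp: line_of_def p q v)+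
  ultimately show ?thesis by blast
qed

lemma line_autosD:
  assumes "T \<in> line_autos n"
  shows "T ` cube n = cube n" "inj_on T (cube n)" "\<And>p. p \<in> cube n \<Longrightarrow> T p \<in> cube n"
    "\<And>L. is_line n L \<Longrightarrow> is_line n (T ` L)"
  using assms by (auto simp: line_autos_def BijGroup_def Bij_def bij_betw_def)

text \<open>The form in which line preservation is applied later: an arithmetic condition on the
  coordinates of two images that limits where they can lie.\<close>

lemma line_autos_aligned:
  assumes "2 \<le> n" "T \<in> line_autos n" "p \<in> cube n" "q \<in> cube n" "p \<noteq> q" "aligned n p q"
  shows "aligned n (T p) (T q)"
proof -
  obtain L where "is_line n L" "p \<in> L" "q \<in> L"
    using aligned_is_line assms by metis
  then show ?thesis
    using is_line_aligned[OF assms(1)] line_autosD(4)[OF assms(2)] by blast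
qed

section \<open>Counting lines through a point\<close>

definition lines_through :: "nat \<Rightarrow> point \<Rightarrow> point set set" where
  "lines_through n p = {L. is_line n L \<and> p \<in> L}"

lemma finite_lines_through: "finite (lines_through n p)"
  by (rule finite_subset[of _ "Pow (cube n)"]) (auto simp: lines_through_def is_line_def cube_def)

text \<open>Taking images under the injective map \<open>T\<close> embeds the lines through
  \<open>p\<close> into those through \<open>T p\<close>.\<close>

lemma card_lines_through_le:
  assumes "T \<in> line_autos n"
  shows "card (lines_through n p) \<le> card (lines_through n (T p))"
proof (rule card_inj_on_le[of "(`) T"])
  have "lines_through n p \<subseteq> Pow (cube n)"
    by (auto simp: lines_through_def is_line_def)
  then show "inj_on ((`) T) (lines_through n p)"
    using inj_on_image_Pow[OF line_autosD(2)[OF assms]] inj_on_subset by blast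
  show "(`) T ` lines_through n p \<subseteq> lines_through n (T p)"
    using line_autosD(4)[OF assms] by (auto simp: lines_through_def)
qed (rule finite_lines_through)

fun on_main_diagonal :: "nat \<Rightarrow> point \<Rightarrow> bool" where
  "on_main_diagonal n (x, y, z) \<longleftrightarrow> (y = x \<or> y = n - Suc x) \<and> (z = x \<or> z = n - Suc x)"

lemma line_of_cong:
  assumes "\<And>i. i < n \<Longrightarrow> f i = f' i" "\<And>i. i < n \<Longrightarrow> g i = g' i" "\<And>i. i < n \<Longrightarrow> h i = h' i"
  shows "line_of n f g h = line_of n f' g' h'"
  using assms by (force simp: line_of_def)

text \<open>Running through a line backwards gives the same set; in the upper count this identifies
  the two parametrisations of a line.\<close>

lemma line_of_reverse:
  "line_of n (\<lambda>i. f (n - Suc i)) (\<lambda>i. g (n - Suc i)) (\<lambda>i. h (n - Suc i)) = line_of n f g h"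
proof -
  have "bij_betw (\<lambda>i. n - Suc i) {..<n} {..<n}"
    by (rule bij_betw_byWitness[where f' = "\<lambda>i. n - Suc i"]) auto
  then have "{..<n} = (\<lambda>i. n - Suc i) ` {..<n}"
    by (simp add: bij_betw_def)
  then show ?thesis
    unfolding line_of_def by (metis (no_types, lifting) image_cong image_image)
qed

text \<open>\<open>traverses\<close> and \<open>stays\<close> prescribe values only below
  \<open>n\<close>. Replacing the sequences by literal functions, with constants read off from the
  given point, allows lines to be compared as terms.\<close>

lemma line_through_cases:
  assumes "2 \<le> n" "is_line n L" "(x, y, z) \<in> L"
  obtains f g h where "L = line_of n f g h"
    "f = (\<lambda>i. i) \<or> f = (\<lambda>i. n - Suc i) \<or> f = (\<lambda>_. x)"
    "g = (\<lambda>i. i) \<or> g = (\<lambda>i. n - Suc i) \<or> g = (\<lambda>_. y)"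
    "h = (\<lambda>i. i) \<or> h = (\<lambda>i. n - Suc i) \<or> h = (\<lambda>_. z)"
    "f \<noteq> (\<lambda>_. x) \<or> g \<noteq> (\<lambda>_. y) \<or> h \<noteq> (\<lambda>_. z)"
    "\<exists>i<n. f i = x \<and> g i = y \<and> h i = z"
proof -
  have *: "\<exists>f'. (\<forall>j<n. f j = f' j) \<and> (f' = (\<lambda>i. i) \<or> f' = (\<lambda>i. n - Suc i) \<or> f' = (\<lambda>_. f i))
     \<and> (traverses n f \<longrightarrow> f' \<noteq> (\<lambda>_. f i))"
    if "traverses n f \<or> stays n f" "i < n" for f i
  proof (cases "traverses n f")
    case True
    have "(\<lambda>i. i) \<noteq> (\<lambda>_. f i)" "(\<lambda>i. n - Suc i) \<noteq> (\<lambda>_. f i)"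
      using \<open>2 \<le> n\<close> fun_cong[of "\<lambda>i. i" "\<lambda>_. f i" 0] fun_cong[of "\<lambda>i. i" "\<lambda>_. f i" 1]
        fun_cong[of "\<lambda>i. n - Suc i" "\<lambda>_. f i" 0] fun_cong[of "\<lambda>i. n - Suc i" "\<lambda>_. f i" 1]
      by auto
    moreover from True consider "\<forall>j<n. f j = j" | "\<forall>j<n. f j = n - Suc j"
      by (auto simp: traverses_def)
    ultimately show ?thesis
      by cases (rule exI[of _ "\<lambda>i. i"], simp, rule exI[of _ "\<lambda>i. n - Suc i"], simp)
  next
    case False
    with that have "stays n f" by simp
    then show ?thesis using False that by (intro exI[of _ "\<lambda>_. f i"]) (auto simp: stays_def)
  qed
  obtain f g h where L: "L = line_of n f g h"
    and fgh: "traverses n f \<or> stays n f" "traverses n g \<or> stays n g" "traverses n h \<or> stays n h"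
    and t: "traverses n f \<or> traverses n g \<or> traverses n h"
    using assms(2) is_line_iff[OF assms(1)] by auto
  obtain i where i: "i < n" "f i = x" "g i = y" "h i = z"
    using assms(3) by (auto simp: L line_of_def)
  obtain f' where f': "\<forall>j<n. f j = f' j" "f' = (\<lambda>i. i) \<or> f' = (\<lambda>i. n - Suc i) \<or> f' = (\<lambda>_. x)"
    "traverses n f \<longrightarrow> f' \<noteq> (\<lambda>_. x)" using *[OF fgh(1) i(1), unfolded i] by (elim exE conjE) (rule that)
  obtain g' where g': "\<forall>j<n. g j = g' j" "g' = (\<lambda>i. i) \<or> g' = (\<lambda>i. n - Suc i) \<or> g' = (\<lambda>_. y)"
    "traverses n g \<longrightarrow> g' \<noteq> (\<lambda>_. y)" using *[OF fgh(2) i(1), unfolded i] by (elim exE conjE) (rule that)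
  obtain h' where h': "\<forall>j<n. h j = h' j" "h' = (\<lambda>i. i) \<or> h' = (\<lambda>i. n - Suc i) \<or> h' = (\<lambda>_. z)"
    "traverses n h \<longrightarrow> h' \<noteq> (\<lambda>_. z)" using *[OF fgh(3) i(1), unfolded i] by (elim exE conjE) (rule that)
  show thesis
  proof (rule that)
    show "L = line_of n f' g' h'" unfolding L using f'(1) g'(1) h'(1) by (intro line_of_cong) auto
    show "\<exists>i<n. f' i = x \<and> g' i = y \<and> h' i = z" 
      using i f'(1) g'(1) h'(1) by (intro exI[of _ i]) simp
    show "f' \<noteq> (\<lambda>_. x) \<or> g' \<noteq> (\<lambda>_. y) \<or> h' \<noteq> (\<lambda>_. z)"
      using t f'(3) g'(3) h'(3) by argo
  qed (rule f'(2) g'(2) h'(2))+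
qed

text \<open>Two coordinates that both move along a line through the point are equal or reflected
  there. Off the main diagonals this happens for at most one pair of coordinates, so three
  axis-parallel lines and two diagonals of one plane are the only candidates.\<close>

lemma card_lines_through_le_5:
  assumes "2 \<le> n" "(x, y, z) \<in> cube n" "\<not> on_main_diagonal n (x, y, z)"
  shows "card (lines_through n (x, y, z)) \<le> 5"
proof -
  define axes where "axes = {line_of n (\<lambda>i. i) (\<lambda>_. y) (\<lambda>_. z), line_of n (\<lambda>_. x) (\<lambda>i. i) (\<lambda>_. z),
    line_of n (\<lambda>_. x) (\<lambda>_. y) (\<lambda>i. i)}"
  define xy where "xy \<longleftrightarrow> y = x \<or> y = n - Suc x"
  define xz where "xz \<longleftrightarrow> z = x \<or> z = n - Suc x"
  define yz where "yz \<longleftrightarrow> z = y \<or> z = n - Suc y"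
  \<comment> \<open>Both diagonals of the plane are listed even if the point lies on one of them or
    on none, as only an upper bound is claimed.\<close>
  define diag where "diag = (if xy
      then {line_of n (\<lambda>i. i) (\<lambda>i. i) (\<lambda>_. z), line_of n (\<lambda>i. i) (\<lambda>i. n - Suc i) (\<lambda>_. z)}
    else if xz
      then {line_of n (\<lambda>i. i) (\<lambda>_. y) (\<lambda>i. i), line_of n (\<lambda>i. i) (\<lambda>_. y) (\<lambda>i. n - Suc i)}
    else {line_of n (\<lambda>_. x) (\<lambda>i. i) (\<lambda>i. i), line_of n (\<lambda>_. x) (\<lambda>i. i) (\<lambda>i. n - Suc i)})"
  have lt: "x < n" "y < n" "z < n" using assms(2) by (auto simp: cube_def)
  \<comment> \<open>Two related pairs would relate all coordinates and put the point on a main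
    diagonal.\<close>
  have excl: "\<not> (xy \<and> xz)" "\<not> (xy \<and> yz)" "\<not> (xz \<and> yz)"
    using assms(3) lt by (auto simp: xy_def xz_def yz_def)
  have "L \<in> axes \<union> diag" if L_through: "is_line n L" "(x, y, z) \<in> L" for L
  proof -
    have flip:
      "line_of n (\<lambda>i. n - Suc i) (\<lambda>_. y) (\<lambda>_. z) = line_of n (\<lambda>i. i) (\<lambda>_. y) (\<lambda>_. z)"
      "line_of n (\<lambda>_. x) (\<lambda>i. n - Suc i) (\<lambda>_. z) = line_of n (\<lambda>_. x) (\<lambda>i. i) (\<lambda>_. z)"
      "line_of n (\<lambda>_. x) (\<lambda>_. y) (\<lambda>i. n - Suc i) = line_of n (\<lambda>_. x) (\<lambda>_. y) (\<lambda>i. i)"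
      "line_of n (\<lambda>i. n - Suc i) (\<lambda>i. n - Suc i) (\<lambda>_. z) = line_of n (\<lambda>i. i) (\<lambda>i. i) (\<lambda>_. z)"
      "line_of n (\<lambda>i. n - Suc i) (\<lambda>_. y) (\<lambda>i. n - Suc i) = line_of n (\<lambda>i. i) (\<lambda>_. y) (\<lambda>i. i)"
      "line_of n (\<lambda>_. x) (\<lambda>i. n - Suc i) (\<lambda>i. n - Suc i) = line_of n (\<lambda>_. x) (\<lambda>i. i) (\<lambda>i. i)"
      "line_of n (\<lambda>i. n - Suc i) (\<lambda>i. i) (\<lambda>_. z) = line_of n (\<lambda>i. i) (\<lambda>i. n - Suc i) (\<lambda>_. z)"
      "line_of n (\<lambda>i. n - Suc i) (\<lambda>_. y) (\<lambda>i. i) = line_of n (\<lambda>i. i) (\<lambda>_. y) (\<lambda>i. n - Suc i)"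
      "line_of n (\<lambda>_. x) (\<lambda>i. n - Suc i) (\<lambda>i. i) = line_of n (\<lambda>_. x) (\<lambda>i. i) (\<lambda>i. n - Suc i)"
      by (subst line_of_reverse[symmetric], rule line_of_cong; simp)+
    obtain f g h where L: "L = line_of n f g h"
      and f: "f = (\<lambda>i. i) \<or> f = (\<lambda>i. n - Suc i) \<or> f = (\<lambda>_. x)"
      and g: "g = (\<lambda>i. i) \<or> g = (\<lambda>i. n - Suc i) \<or> g = (\<lambda>_. y)"
      and h: "h = (\<lambda>i. i) \<or> h = (\<lambda>i. n - Suc i) \<or> h = (\<lambda>_. z)"
      and nt: "f \<noteq> (\<lambda>_. x) \<or> g \<noteq> (\<lambda>_. y) \<or> h \<noteq> (\<lambda>_. z)"
      and v: "\<exists>i<n. f i = x \<and> g i = y \<and> h i = z"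
      by (rule line_through_cases[OF assms(1) L_through])
    obtain i where i: "i < n" "f i = x" "g i = y" "h i = z" using v by blast
    have "f = (\<lambda>_. x) \<or> g = (\<lambda>_. y) \<or> xy"
      using f g i(1) unfolding xy_def i(2,3)[symmetric] by (elim disjE) simp_all
    moreover have "f = (\<lambda>_. x) \<or> h = (\<lambda>_. z) \<or> xz"
      using f h i(1) unfolding xz_def i(2,4)[symmetric] by (elim disjE) simp_all
    moreover have "g = (\<lambda>_. y) \<or> h = (\<lambda>_. z) \<or> yz"
      using g h i(1) unfolding yz_def i(3,4)[symmetric] by (elim disjE) simp_all
    ultimately consider
        "f \<noteq> (\<lambda>_. x)" "g = (\<lambda>_. y)" "h = (\<lambda>_. z)"
      | "f = (\<lambda>_. x)" "g \<noteq> (\<lambda>_. y)" "h = (\<lambda>_. z)"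
      | "f = (\<lambda>_. x)" "g = (\<lambda>_. y)" "h \<noteq> (\<lambda>_. z)"
      | "f \<noteq> (\<lambda>_. x)" "g \<noteq> (\<lambda>_. y)" "h = (\<lambda>_. z)" xy
      | "f \<noteq> (\<lambda>_. x)" "g = (\<lambda>_. y)" "h \<noteq> (\<lambda>_. z)" "\<not> xy" xz
      | "f = (\<lambda>_. x)" "g \<noteq> (\<lambda>_. y)" "h \<noteq> (\<lambda>_. z)" "\<not> xy" "\<not> xz"
      using nt excl by argo
    then show ?thesis
    proof cases
      case 1 with f show ?thesis by (elim disjE) (simp_all add: L axes_def flip)
    next
      case 2 with g show ?thesis by (elim disjE) (simp_all add: L axes_def flip)
    next
      case 3 with h show ?thesis by (elim disjE) (simp_all add: L axes_def flip)
    next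
      case 4 with f g show ?thesis by (elim disjE) (simp_all add: L diag_def flip)
    next
      case 5 with f h show ?thesis by (elim disjE) (simp_all add: L diag_def flip)
    next
      case 6 with g h show ?thesis by (elim disjE) (simp_all add: L diag_def flip)
    qed
  qed
  then have "lines_through n (x, y, z) \<subseteq> axes \<union> diag"
    unfolding lines_through_def by blast
  moreover have "finite (axes \<union> diag)"
    by (simp add: axes_def diag_def)
  ultimately have "card (lines_through n (x, y, z)) \<le> card (axes \<union> diag)"
    by (rule card_mono[rotated])
  also have "\<dots> \<le> card axes + card diag"
    by (rule card_Un_le)
  also have "card axes \<le> 3"
    by (simp add: axes_def card_insert_if)
  also have "card diag \<le> 2"
    by (simp add: diag_def card_insert_if)
  finally show ?thesis by simp
qed

text \<open>The three axis-parallel lines and one diagonal in each of the three axis-parallel planes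
  through the point already make six.\<close>

lemma card_lines_through_ge_6:
  assumes "2 \<le> n" "(x, y, z) \<in> cube n" "on_main_diagonal n (x, y, z)"
  shows "6 \<le> card (lines_through n (x, y, z))"
proof -
  have lt: "x < n" "y < n" "z < n" using assms(2) by (auto simp: cube_def)
  \<comment> \<open>The directions, relative to the first coordinate, of a main diagonal through the
    point; the planar diagonals below meet the point at index \<open>x\<close>.\<close>
  obtain g h where g: "g = (\<lambda>i. i) \<or> g = (\<lambda>i. n - Suc i)" "g x = y"
    and h: "h = (\<lambda>i. i) \<or> h = (\<lambda>i. n - Suc i)" "h x = z"
    using assms(3) by fastforce
  define S where "S = {line_of n (\<lambda>i. i) (\<lambda>_. y) (\<lambda>_. z), line_of n (\<lambda>_. x) (\<lambda>i. i) (\<lambda>_. z),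
    line_of n (\<lambda>_. x) (\<lambda>_. y) (\<lambda>i. i), line_of n (\<lambda>i. i) g (\<lambda>_. z), line_of n (\<lambda>i. i) (\<lambda>_. y) h,
    line_of n (\<lambda>_. x) g h}"
  \<comment> \<open>\<open>shape\<close> records which coordinates are constant along a line. It
    depends only on the point set and takes six different values on \<open>S\<close>.\<close>
  define shape :: "point set \<Rightarrow> bool \<times> bool \<times> bool"
    where "shape L = (\<forall>(a, b, c)\<in>L. a = x, \<forall>(a, b, c)\<in>L. b = y, \<forall>(a, b, c)\<in>L. c = z)" for L
  have shape: "shape (line_of n f g h) = (\<forall>i<n. f i = x, \<forall>i<n. g i = y, \<forall>i<n. h i = z)" for f g h
    by (auto simp: shape_def line_of_def)
  have nid: "\<not> (\<forall>i<n. i = a)" "\<not> (\<forall>i<n. n - Suc i = a)" for a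
  proof -
    have "0 < n" "1 < n" "n - Suc 1 \<noteq> n - Suc 0"
      using assms(1) by auto
    then show "\<not> (\<forall>i<n. i = a)" "\<not> (\<forall>i<n. n - Suc i = a)"
      by (metis zero_neq_one, metis)
  qed
  have tr: "traverses n (\<lambda>i. i)" "traverses n g" "traverses n h"
    using g h by (auto simp: traverses_def)
  have st: "stays n (\<lambda>_. x)" "stays n (\<lambda>_. y)" "stays n (\<lambda>_. z)"
    using lt by (auto simp: stays_def)
  have "shape ` S = {(False, True, True), (True, False, True), (True, True, False),
    (False, False, True), (False, True, False), (True, False, False)}"
  proof -
    have "\<not> (\<forall>i<n. g i = y)" "\<not> (\<forall>i<n. h i = z)" "\<not> (\<forall>i<n. i = x)"
      "\<not> (\<forall>i<n. i = y)" "\<not> (\<forall>i<n. i = z)"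
      using g(1) h(1) nid by auto
    then show ?thesis unfolding S_def image_insert image_empty shape by (simp only: simp_thms)
  qed
  then have "card (shape ` S) = 6" by simp
  moreover have "card (shape ` S) \<le> card S"
    by (rule card_image_le) (simp add: S_def)
  moreover have "S \<subseteq> lines_through n (x, y, z)"
  proof -
    have "L \<in> S \<Longrightarrow> is_line n L" for L
      unfolding is_line_iff[OF assms(1)] S_def using tr st by blast
    moreover have "L \<in> S \<Longrightarrow> (x, y, z) \<in> L" for L
      using lt g h by (auto simp: S_def line_of_def)
    ultimately show ?thesis by (auto simp: lines_through_def)
  qed
  then have "card S \<le> card (lines_through n (x, y, z))"
    by (rule card_mono[OF finite_lines_through])
  ultimately show ?thesis by simp
qed

lemma line_autos_on_main_diagonal:
  assumes "2 \<le> n" "T \<in> line_autos n" "p \<in> cube n" "on_main_diagonal n p"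
  shows "on_main_diagonal n (T p)"
proof (rule ccontr)
  assume "\<not> on_main_diagonal n (T p)"
  then have "card (lines_through n (T p)) \<le> 5"
    using card_lines_through_le_5[OF assms(1)] line_autosD(3)[OF assms(2,3)]
    by (cases "T p") simp
  moreover have "6 \<le> card (lines_through n p)"
    using card_lines_through_ge_6[OF assms(1)] assms(3,4) by (cases p) simp
  ultimately show False
    using card_lines_through_le[OF assms(2), of p] by linarith
qed

section \<open>Rotations and coordinate permutations preserve lines\<close>

lemma line_autosI:
  assumes "2 \<le> n" "T \<in> carrier (BijGroup (cube n))"
    and "\<And>f g h. \<lbrakk>traverses n f \<or> stays n f; traverses n g \<or> stays n g; traverses n h \<or> stays n h;
      traverses n f \<or> traverses n g \<or> traverses n h\<rbrakk> \<Longrightarrow> is_line n (T ` line_of n f g h)"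
  shows "T \<in> line_autos n"
  unfolding line_autos_def using assms(2,3) is_line_iff[OF assms(1)] by auto

lemma line_of_in_cube:
  assumes "traverses n f \<or> stays n f" "traverses n g \<or> stays n g" "traverses n h \<or> stays n h" "i < n"
  shows "(f i, g i, h i) \<in> cube n"
  using assms traverses_less stays_less by (auto simp: cube_def)

lemma traverses_reflect: "traverses n f \<Longrightarrow> traverses n (\<lambda>i. n - f i - 1)"
  by (auto simp: traverses_def)

lemma stays_reflect:
  assumes "stays n f"
  shows "stays n (\<lambda>i. n - f i - 1)"
proof -
  obtain c where "c < n" "\<forall>i<n. f i = c"
    using assms by (auto simp: stays_def)
  then show ?thesis
    unfolding stays_def by (intro exI[of _ "n - c - 1"]) simp
qed

lemma rot_line_autos:
  assumes "2 \<le> n"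
  shows "rot_x n \<in> line_autos n" "rot_y n \<in> line_autos n" "rot_z n \<in> line_autos n"
proof -
  note reflect = traverses_reflect stays_reflect
  have "is_line n (rot_x n ` line_of n f g h)" "is_line n (rot_y n ` line_of n f g h)"
    "is_line n (rot_z n ` line_of n f g h)"
    if fgh: "traverses n f \<or> stays n f" "traverses n g \<or> stays n g" "traverses n h \<or> stays n h"
    and t: "traverses n f \<or> traverses n g \<or> traverses n h" for f g h
  proof -
    have "rot_x n ` line_of n f g h = line_of n f (\<lambda>i. n - h i - 1) g"
      "rot_y n ` line_of n f g h = line_of n (\<lambda>i. n - h i - 1) g f"
      "rot_z n ` line_of n f g h = line_of n (\<lambda>i. n - g i - 1) f h"
      using line_of_in_cube[OF fgh] unfolding line_of_def image_image
      by (intro image_cong refl; simp add: rot_x_def rot_y_def rot_z_def)+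
    moreover have "traverses n (\<lambda>i. n - h i - 1) \<or> stays n (\<lambda>i. n - h i - 1)"
      "traverses n (\<lambda>i. n - g i - 1) \<or> stays n (\<lambda>i. n - g i - 1)"
      using fgh reflect by blast+
    ultimately show "is_line n (rot_x n ` line_of n f g h)" "is_line n (rot_y n ` line_of n f g h)"
      "is_line n (rot_z n ` line_of n f g h)"
      unfolding is_line_iff[OF assms] using fgh t reflect by blast+
  qed
  then show "rot_x n \<in> line_autos n" "rot_y n \<in> line_autos n" "rot_z n \<in> line_autos n"
    using line_autosI[OF assms] rot_in_carrier by blast+
qed

text \<open>Reparametrising the image by the inverse of \<open>\<pi>\<close> conjugates each
  coordinate sequence with \<open>\<pi>\<close>. Conjugation keeps the identity, keeps the reversal
  because \<open>\<pi>\<close> commutes with it, and keeps constants constant.\<close>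

lemma perm_line_autos:
  assumes "2 \<le> n" "\<pi> permutes {..<n}" "\<forall>p<n. \<pi> (n - p - 1) = n - \<pi> p - 1"
  shows "perm_map n \<pi> \<in> line_autos n"
proof (rule line_autosI[OF assms(1)])
  show "perm_map n \<pi> \<in> carrier (BijGroup (cube n))"
    using perm_group_subset assms(2,3) by (auto simp: perm_group_def)
next
  fix f g h
  assume fgh: "traverses n f \<or> stays n f" "traverses n g \<or> stays n g" "traverses n h \<or> stays n h"
    and t: "traverses n f \<or> traverses n g \<or> traverses n h"
  let ?c = "\<lambda>f i. \<pi> (f (inv_into UNIV \<pi> i))"
  have lt: "\<pi> i < n \<longleftrightarrow> i < n" "inv_into UNIV \<pi> i < n \<longleftrightarrow> i < n" for i
    using permutes_in_image[OF assms(2)] permutes_in_image[OF permutes_inv[OF assms(2)]] by auto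
  have tr: "traverses n (?c f)" if "traverses n f" for f
    using that assms(3) lt by (auto simp: traverses_def permutes_inverses[OF assms(2)])
  have st: "stays n (?c f)" if f: "stays n f" for f
  proof -
    obtain c where "c < n" "\<forall>i<n. f i = c"
      using f by (auto simp: stays_def)
    then show ?thesis
      unfolding stays_def by (intro exI[of _ "\<pi> c"]) (simp add: lt)
  qed
  have "inv_into UNIV \<pi> ` {..<n} = {..<n}"
    using permutes_image[OF permutes_inv[OF assms(2)]] .
  then have "line_of n f g h = (\<lambda>i. (f (inv_into UNIV \<pi> i), g (inv_into UNIV \<pi> i), h (inv_into UNIV \<pi> i))) ` {..<n}"
    unfolding line_of_def by (metis (no_types, lifting) image_cong image_image)
  then have "perm_map n \<pi> ` line_of n f g h =
      (\<lambda>i. perm_map n \<pi> (f (inv_into UNIV \<pi> i), g (inv_into UNIV \<pi> i), h (inv_into UNIV \<pi> i))) ` {..<n}"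
    by (simp add: image_image)
  also have "\<dots> = line_of n (?c f) (?c g) (?c h)"
    unfolding line_of_def using line_of_in_cube[OF fgh] lt
    by (intro image_cong refl) (simp add: perm_map_def)
  finally have "perm_map n \<pi> ` line_of n f g h = line_of n (?c f) (?c g) (?c h)" .
  moreover have "traverses n (?c f) \<or> stays n (?c f)" "traverses n (?c g) \<or> stays n (?c g)"
    "traverses n (?c h) \<or> stays n (?c h)"
    using fgh tr st by blast+
  ultimately show "is_line n (perm_map n \<pi> ` line_of n f g h)"
    unfolding is_line_iff[OF assms(1)] using t tr by blast
qed

section \<open>Symmetries available for the normalisation\<close>

text \<open>Both memberships are tracked together: \<open>std_autos\<close> is what the theorem asks
  of \<open>A\<close>, and \<open>line_autos\<close> makes the composite of \<open>T\<close> with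
  \<open>A\<close> an automorphism again.\<close>

definition sym_autos :: "nat \<Rightarrow> (point \<Rightarrow> point) set" where
  "sym_autos n = std_autos n \<inter> line_autos n"

lemma line_autos_carrier: "T \<in> line_autos n \<Longrightarrow> T \<in> carrier (BijGroup (cube n))"
  by (simp add: line_autos_def)

text \<open>The product of \<open>BijGroup\<close> composes from right to left, hence the exchanged
  factors.\<close>

lemma comp_lr_eq_mult:
  assumes "A \<in> carrier (BijGroup (cube n))" "B \<in> carrier (BijGroup (cube n))"
  shows "comp_lr n A B = B \<otimes>\<^bsub>BijGroup (cube n)\<^esub> A"
  using assms by (simp add: BijGroup_def comp_lr_def compose_def)

lemma comp_lr_std_autos: "A \<in> std_autos n \<Longrightarrow> B \<in> std_autos n \<Longrightarrow> comp_lr n A B \<in> std_autos n"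
  using std_autos_subgroup[of n]
  by (simp add: comp_lr_eq_mult subgroup.m_closed subgroup.mem_carrier)

lemma comp_lr_line_autos:
  assumes "A \<in> line_autos n" "B \<in> line_autos n"
  shows "comp_lr n A B \<in> line_autos n"
proof -
  have "comp_lr n A B \<in> carrier (BijGroup (cube n))"
    using assms[THEN line_autos_carrier] monoid.m_closed[OF group.is_monoid[OF group_BijGroup]]
    by (simp add: comp_lr_eq_mult)
  moreover have "is_line n (comp_lr n A B ` L)" if "is_line n L" for L
  proof -
    have "L \<subseteq> cube n" using that by (simp add: is_line_def)
    then have "comp_lr n A B ` L = B ` A ` L"
      unfolding comp_lr_def image_image by (intro image_cong) auto
    then show ?thesis
      using that assms by (simp add: line_autosD(4))
  qed
  ultimately show ?thesis by (simp add: line_autos_def)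
qed

lemma comp_lr_sym_autos: "A \<in> sym_autos n \<Longrightarrow> B \<in> sym_autos n \<Longrightarrow> comp_lr n A B \<in> sym_autos n"
  by (simp add: sym_autos_def comp_lr_std_autos comp_lr_line_autos)

lemma perm_sym_autos:
  assumes "2 \<le> n" "\<pi> permutes {..<n}" "\<forall>p<n. \<pi> (n - p - 1) = n - \<pi> p - 1"
  shows "perm_map n \<pi> \<in> sym_autos n"
  using perm_line_autos[OF assms] assms(2,3)
  unfolding sym_autos_def std_autos_def perm_group_def by (blast intro: generate.incl)

lemma rot_sym_autos:
  assumes "2 \<le> n"
  shows "rot_x n \<in> sym_autos n" "rot_y n \<in> sym_autos n" "rot_z n \<in> sym_autos n"
  using rot_line_autos[OF assms]
  unfolding sym_autos_def std_autos_def rot_group_def by (blast intro: generate.incl)+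

abbreviation refl_x :: "nat \<Rightarrow> point \<Rightarrow> point" where
  "refl_x n \<equiv> restrict (\<lambda>(x, y, z). (n - Suc x, y, z)) (cube n)"

abbreviation refl_y :: "nat \<Rightarrow> point \<Rightarrow> point" where
  "refl_y n \<equiv> restrict (\<lambda>(x, y, z). (x, n - Suc y, z)) (cube n)"

abbreviation refl_z :: "nat \<Rightarrow> point \<Rightarrow> point" where
  "refl_z n \<equiv> restrict (\<lambda>(x, y, z). (x, y, n - Suc z)) (cube n)"

abbreviation swap_xy :: "nat \<Rightarrow> point \<Rightarrow> point" where
  "swap_xy n \<equiv> restrict (\<lambda>(x, y, z). (y, x, z)) (cube n)"

abbreviation swap_yz :: "nat \<Rightarrow> point \<Rightarrow> point" where
  "swap_yz n \<equiv> restrict (\<lambda>(x, y, z). (x, z, y)) (cube n)"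

text \<open>The rotations alone are orientation preserving. The reversal \<open>i \<mapsto> n - 1 - i\<close> contributes the
  central inversion, and with it all reflections and coordinate swaps.\<close>

lemma reflection_sym_autos:
  assumes "2 \<le> n"
  shows "refl_x n \<in> sym_autos n" "refl_y n \<in> sym_autos n" "refl_z n \<in> sym_autos n"
proof -
  \<comment> \<open>The reversal, continued by the identity above \<open>n\<close> as
    \<open>permutes\<close> demands.\<close>
  define \<rho> where "\<rho> = (\<lambda>i. if i < n then n - Suc i else i)"
  have "bij_betw \<rho> {..<n} {..<n}"
    by (rule bij_betw_byWitness[where f' = \<rho>]) (auto simp: \<rho>_def)
  then have "\<rho> permutes {..<n}"
    by (rule bij_imp_permutes) (simp add: \<rho>_def)
  then have inv: "perm_map n \<rho> \<in> sym_autos n"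
    by (rule perm_sym_autos[OF assms]) (auto simp: \<rho>_def)
  \<comment> \<open>A half-turn about an axis followed by the central inversion is the reflection
    along that axis.\<close>
  have "refl_x n = comp_lr n (comp_lr n (rot_x n) (rot_x n)) (perm_map n \<rho>)"
    "refl_y n = comp_lr n (comp_lr n (rot_y n) (rot_y n)) (perm_map n \<rho>)"
    "refl_z n = comp_lr n (comp_lr n (rot_z n) (rot_z n)) (perm_map n \<rho>)"
    unfolding comp_lr_def
    by (intro restrict_ext; force simp: rot_x_def rot_y_def rot_z_def perm_map_def cube_def \<rho>_def)+
  then show "refl_x n \<in> sym_autos n" "refl_y n \<in> sym_autos n" "refl_z n \<in> sym_autos n"
    using inv rot_sym_autos[OF assms] by (simp_all add: comp_lr_sym_autos)
qed

lemma swap_sym_autos: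
  assumes "2 \<le> n"
  shows "swap_xy n \<in> sym_autos n" "swap_yz n \<in> sym_autos n"
proof -
  \<comment> \<open>A quarter-turn exchanges two coordinates and reflects one of them; the
    reflection is undone.\<close>
  have "swap_xy n = comp_lr n (rot_z n) (refl_x n)" "swap_yz n = comp_lr n (rot_x n) (refl_y n)"
    unfolding comp_lr_def
    by (intro restrict_ext; force simp: rot_x_def rot_z_def cube_def)+
  then show "swap_xy n \<in> sym_autos n" "swap_yz n \<in> sym_autos n"
    using rot_sym_autos[OF assms] reflection_sym_autos[OF assms] by (simp_all add: comp_lr_sym_autos)
qed

text \<open>The conclusion of the theorem as a property of \<open>T\<close>, to be carried back
  through successive adjustments of \<open>T\<close>.\<close>

definition normalizable :: "nat \<Rightarrow> (point \<Rightarrow> point) \<Rightarrow> bool" where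
  "normalizable n T \<longleftrightarrow> (\<exists>A\<in>std_autos n.
     (\<forall>p\<in>corners n. comp_lr n T A p = p) \<and>
     (\<forall>p\<in>{(i, 0, 0) | i. i < n}. comp_lr n T A p = p))"

text \<open>Composition is associative and standard automorphisms are closed under it, so the two
  adjustments merge into one.\<close>

lemma normalizable_comp_lr:
  assumes "T \<in> line_autos n" "A \<in> sym_autos n" "normalizable n (comp_lr n T A)"
  shows "normalizable n T"
proof -
  obtain B where B: "B \<in> std_autos n" "\<forall>p\<in>corners n. comp_lr n (comp_lr n T A) B p = p"
     "\<forall>p\<in>{(i, 0, 0) | i. i < n}. comp_lr n (comp_lr n T A) B p = p"
    using assms(3) by (auto simp: normalizable_def)
  have "comp_lr n (comp_lr n T A) B = comp_lr n T (comp_lr n A B)"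
    using line_autosD(3)[OF assms(1)] by (auto simp: comp_lr_def fun_eq_iff)
  moreover have "comp_lr n A B \<in> std_autos n"
    using assms(2) B(1) by (simp add: sym_autos_def comp_lr_std_autos)
  ultimately show ?thesis
    using B(2,3) unfolding normalizable_def by (intro bexI[of _ "comp_lr n A B"]) simp_all
qed

section \<open>The four main diagonals\<close>

text \<open>Here \<open>N\<close> stands for \<open>n - 1\<close>, the largest coordinate. The
  Booleans tell whether the second and the third coordinate run with or against the first.\<close>

definition main_diagonal :: "nat \<Rightarrow> bool \<Rightarrow> bool \<Rightarrow> point set" where
  "main_diagonal N b c = {(i, if b then i else N - i, if c then i else N - i) | i. i \<le> N}"

lemma main_diagonal_line_of:
  "main_diagonal N b c =
   line_of (Suc N) (\<lambda>i. i) (\<lambda>i. if b then i else N - i) (\<lambda>i. if c then i else N - i)"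
  by (auto simp: main_diagonal_def line_of_def)

lemma is_line_main_diagonal:
  assumes "1 \<le> N"
  shows "is_line (Suc N) (main_diagonal N b c)"
proof -
  have "traverses (Suc N) (\<lambda>i. i)" "traverses (Suc N) (\<lambda>i. if d then i else N - i)" for d
    by (auto simp: traverses_def)
  then show ?thesis
    using assms unfolding main_diagonal_line_of by (subst is_line_iff) auto
qed

text \<open>A traversing sequence takes \<open>N + 1\<close> different values, at least three, which
  do not fit into a pair.\<close>

lemma traverses_not_in_pair:
  assumes "2 \<le> N" "traverses (Suc N) f"
  shows "\<exists>i\<le>N. f i \<noteq> a \<and> f i \<noteq> b"
proof (rule ccontr)
  assume "\<not> (\<exists>i\<le>N. f i \<noteq> a \<and> f i \<noteq> b)"
  then have "card {..N} \<le> card {a, b}"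
    using traverses_inj_on[OF assms(2)]
    by (intro card_inj_on_le[of f]) (auto simp: lessThan_Suc_atMost)
  also have "card {a, b} \<le> 2"
    by (simp add: card_insert_if)
  finally show False
    using assms(1) by simp
qed

text \<open>A coordinate staying at \<open>a\<close> would confine the others to \<open>a\<close>
  and \<open>N - a\<close>, too few values for a traversing one. So all three coordinates traverse,
  and their relative directions name the diagonal.\<close>

lemma line_on_main_diagonals:
  assumes "2 \<le> N" "is_line (Suc N) L" "\<forall>p\<in>L. on_main_diagonal (Suc N) p"
  obtains b c where "L = main_diagonal N b c"
proof -
  obtain f g h where L: "L = line_of (Suc N) f g h"
    and fgh: "traverses (Suc N) f \<or> stays (Suc N) f" "traverses (Suc N) g \<or> stays (Suc N) g"
      "traverses (Suc N) h \<or> stays (Suc N) h"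
    and t: "traverses (Suc N) f \<or> traverses (Suc N) g \<or> traverses (Suc N) h"
    using assms(1,2) by (auto simp: is_line_iff)
  have lt: "f i \<le> N" "g i \<le> N" "h i \<le> N" if "i \<le> N" for i
    using line_of_in_cube[OF fgh, of i] that by (auto simp: cube_def)
  have d: "(g i = f i \<or> g i = N - f i) \<and> (h i = f i \<or> h i = N - f i)" if "i \<le> N" for i
    using assms(3) that by (auto simp: L line_of_def)
  have "traverses (Suc N) f"
  proof (rule ccontr)
    assume *: "\<not> traverses (Suc N) f"
    then obtain a where "\<forall>i\<le>N. f i = a"
      using fgh(1) by (auto simp: stays_def less_Suc_eq_le)
    with d have "\<forall>i\<le>N. g i = a \<or> g i = N - a" "\<forall>i\<le>N. h i = a \<or> h i = N - a" by auto
    with t * show False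
      using traverses_not_in_pair[OF assms(1), of _ a "N - a"] by blast
  qed
  moreover have "traverses (Suc N) g"
  proof (rule ccontr)
    assume "\<not> traverses (Suc N) g"
    then obtain a where "\<forall>i\<le>N. g i = a"
      using fgh(2) by (auto simp: stays_def less_Suc_eq_le)
    with d lt have "\<forall>i\<le>N. f i = a \<or> f i = N - a" by (metis diff_diff_cancel)
    with \<open>traverses (Suc N) f\<close> show False
      using traverses_not_in_pair[OF assms(1), of _ a "N - a"] by blast
  qed
  moreover have "traverses (Suc N) h"
  proof (rule ccontr)
    assume "\<not> traverses (Suc N) h"
    then obtain a where "\<forall>i\<le>N. h i = a"
      using fgh(3) by (auto simp: stays_def less_Suc_eq_le)
    with d lt have "\<forall>i\<le>N. f i = a \<or> f i = N - a" by (metis diff_diff_cancel)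
    with \<open>traverses (Suc N) f\<close> show False
      using traverses_not_in_pair[OF assms(1), of _ a "N - a"] by blast
  qed
  ultimately have tr: "traverses (Suc N) f" "traverses (Suc N) g" "traverses (Suc N) h" .
  \<comment> \<open>The line is run through backwards if necessary, so that the first coordinate
    increases as in \<open>main_diagonal\<close>.\<close>
  have *: "\<exists>f' g' h'. L = line_of (Suc N) f' g' h' \<and> (\<forall>i\<le>N. f' i = i)
     \<and> traverses (Suc N) g' \<and> traverses (Suc N) h'"
  proof (cases "\<forall>i\<le>N. f i = i")
    case True
    with L tr show ?thesis by blast
  next
    case False
    with tr(1) have "\<forall>i\<le>N. f (N - i) = i"
      by (auto simp: traverses_def less_Suc_eq_le)
    moreover have "traverses (Suc N) (\<lambda>i. k (N - i))" if "traverses (Suc N) k" for k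
      using that by (auto simp: traverses_def less_Suc_eq_le)
    ultimately show ?thesis
      using line_of_reverse[of "Suc N" f g h] L tr
      by (intro exI[of _ "\<lambda>i. f (N - i)"] exI[of _ "\<lambda>i. g (N - i)"] exI[of _ "\<lambda>i. h (N - i)"]) simp
  qed
  then obtain f' g' h' where L': "L = line_of (Suc N) f' g' h'" "\<forall>i\<le>N. f' i = i"
     "traverses (Suc N) g'" "traverses (Suc N) h'" by blast
  have sgn: "\<exists>b. \<forall>i\<le>N. k i = (if b then i else N - i)" if "traverses (Suc N) k" for k
    using that by (cases "\<forall>i\<le>N. k i = i"; intro exI[of _ "\<forall>i\<le>N. k i = i"])
      (auto simp: traverses_def less_Suc_eq_le)
  obtain b c where "\<forall>i\<le>N. g' i = (if b then i else N - i)" "\<forall>i\<le>N. h' i = (if c then i else N - i)"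
    using sgn[OF L'(3)] sgn[OF L'(4)] by blast
  then have "L = main_diagonal N b c"
    unfolding L'(1) main_diagonal_line_of using L'(2) by (intro line_of_cong) auto
  then show thesis by (rule that)
qed

section \<open>Main diagonals under an automorphism\<close>

locale line_automorphism =
  fixes N :: nat and T :: "point \<Rightarrow> point"
  assumes N: "2 \<le> N" and T: "T \<in> line_autos (Suc N)"
begin

lemma in_cube [simp]: "(x, y, z) \<in> cube (Suc N) \<longleftrightarrow> x \<le> N \<and> y \<le> N \<and> z \<le> N"
  by (auto simp: cube_def)

lemma T_in_cube: "p \<in> cube (Suc N) \<Longrightarrow> T p \<in> cube (Suc N)"
  by (rule line_autosD(3)[OF T])

lemma T_eq_iff: "p \<in> cube (Suc N) \<Longrightarrow> q \<in> cube (Suc N) \<Longrightarrow> T p = T q \<longleftrightarrow> p = q"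
  using line_autosD(2)[OF T] by (auto simp: inj_on_def)

lemma T_aligned: "p \<in> cube (Suc N) \<Longrightarrow> q \<in> cube (Suc N) \<Longrightarrow> p \<noteq> q \<Longrightarrow> aligned (Suc N) p q
    \<Longrightarrow> aligned (Suc N) (T p) (T q)"
  using line_autos_aligned[OF _ T] N by simp

lemma T_on_main_diagonal:
  "p \<in> cube (Suc N) \<Longrightarrow> on_main_diagonal (Suc N) p \<Longrightarrow> on_main_diagonal (Suc N) (T p)"
  using line_autos_on_main_diagonal[OF _ T] N by simp

text \<open>The line counts keep the images on main diagonals, and a line consisting of such points
  is itself a main diagonal.\<close>

lemma T_main_diagonal:
  obtains b' c' where "T ` main_diagonal N b c = main_diagonal N b' c'"
proof (rule line_on_main_diagonals[OF N])
  show "is_line (Suc N) (T ` main_diagonal N b c)"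
    using is_line_main_diagonal N by (intro line_autosD(4)[OF T]) simp
  show "\<forall>p\<in>T ` main_diagonal N b c. on_main_diagonal (Suc N) p"
    by (auto simp: main_diagonal_def intro!: T_on_main_diagonal)
qed

text \<open>The centre lies on two main diagonals, whose images are again two different main
  diagonals. A point common to these has a coordinate \<open>i\<close> with
  \<open>i = N - i\<close>.\<close>

lemma T_center:
  assumes "2 * m = N"
  shows "T (m, m, m) = (m, m, m)"
proof -
  obtain b c where D: "T ` main_diagonal N True True = main_diagonal N b c"
    by (rule T_main_diagonal)
  obtain b' c' where D': "T ` main_diagonal N True False = main_diagonal N b' c'"
    by (rule T_main_diagonal)
  have m: "N - m = m" using assms by simp
  have "T (m, m, m) \<in> T ` main_diagonal N True True" "T (m, m, m) \<in> T ` main_diagonal N True False"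
    using m by (auto simp: main_diagonal_def intro!: imageI exI[of _ m])
  then have TD: "T (m, m, m) \<in> main_diagonal N b c" "T (m, m, m) \<in> main_diagonal N b' c'"
    unfolding D D' .
  \<comment> \<open>The origin lies on only one of the two diagonals, so injectivity keeps their
    images apart.\<close>
  have "(0, 0, 0) \<in> main_diagonal N True True" "(0, 0, 0) \<notin> main_diagonal N True False"
    using N by (auto simp: main_diagonal_def)
  moreover have "main_diagonal N b c \<subseteq> cube (Suc N)" for b c
    by (auto simp: main_diagonal_def)
  ultimately have "T ` main_diagonal N True True \<noteq> T ` main_diagonal N True False"
    using inj_on_image_eq_iff[OF line_autosD(2)[OF T]] by metis
  then have "b \<noteq> b' \<or> c \<noteq> c'"
    unfolding D D' by blast
  moreover obtain i where "T (m, m, m) = (i, if b then i else N - i, if c then i else N - i)" "i \<le> N"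
    using TD(1) by (auto simp: main_diagonal_def)
  moreover have "T (m, m, m) = (i, if b' then i else N - i, if c' then i else N - i)"
    using TD(2) calculation(2) by (auto simp: main_diagonal_def)
  ultimately have "T (m, m, m) = (i, if b then i else N - i, if c then i else N - i)" "i = N - i" "i \<le> N"
    by (auto split: if_splits)
  moreover from this(2,3) assms have "i = m" by linarith
  ultimately show ?thesis using m by simp
qed

text \<open>The centre, if there is one, is already its own image and hence excluded here.\<close>

lemma T_origin:
  obtains x y z where "T (0, 0, 0) = (x, y, z)" "x \<le> N" "2 * x \<noteq> N"
    "y = x \<or> y = N - x" "z = x \<or> z = N - x"
proof -
  obtain x y z where xyz: "T (0, 0, 0) = (x, y, z)"
    by (metis surj_pair)
  have "on_main_diagonal (Suc N) (x, y, z)" "(x, y, z) \<in> cube (Suc N)"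
    using T_on_main_diagonal[of "(0, 0, 0)"] T_in_cube[of "(0, 0, 0)"] by (auto simp: xyz)
  then have *: "x \<le> N" "y = x \<or> y = N - x" "z = x \<or> z = N - x" by auto
  moreover have "2 * x \<noteq> N"
  proof
    assume m: "2 * x = N"
    then have "N - x = x" by simp
    with * have "T (0, 0, 0) = T (x, x, x)"
      using T_center[OF m] xyz by auto
    then show False
      using T_eq_iff[of "(0, 0, 0)" "(x, x, x)"] m N by auto
  qed
  ultimately show thesis
    using that xyz by blast
qed

end

section \<open>Returning the image of the origin\<close>

text \<open>Reflections lead to \<open>(x, x, x)\<close>, and a permutation sending \<open>x\<close>
  to 0 finishes. To commute with reversal it has to send \<open>N - x\<close> to \<open>N\<close>,
  which is consistent because \<open>x\<close> and \<open>N - x\<close> differ.\<close>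

lemma exists_sym_auto_to_origin:
  assumes "1 \<le> N" "x \<le> N" "2 * x \<noteq> N" "y = x \<or> y = N - x" "z = x \<or> z = N - x"
  obtains A where "A \<in> sym_autos (Suc N)" "A (x, y, z) = (0, 0, 0)"
proof -
  have n: "2 \<le> Suc N" using assms(1) by simp
  note R = reflection_sym_autos[OF n]
  define Y where "Y = (if y = x then (\<lambda>p\<in>cube (Suc N). p) else refl_y (Suc N))"
  define Z where "Z = (if z = x then (\<lambda>p\<in>cube (Suc N). p) else refl_z (Suc N))"
  \<comment> \<open>The identity is recognised as a symmetry by writing it as a reflection done
    twice.\<close>
  have "(\<lambda>p\<in>cube (Suc N). p) = comp_lr (Suc N) (refl_x (Suc N)) (refl_x (Suc N))"
    unfolding comp_lr_def by (intro restrict_ext) (auto simp: cube_def)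
  then have "(\<lambda>p\<in>cube (Suc N). p) \<in> sym_autos (Suc N)"
    using R by (simp add: comp_lr_sym_autos)
  then have YZ: "Y \<in> sym_autos (Suc N)" "Z \<in> sym_autos (Suc N)"
    using R by (auto simp: Y_def Z_def)
  \<comment> \<open>Exchanges 0 with \<open>x\<close> and, symmetrically, \<open>N\<close> with
    \<open>N - x\<close>. For \<open>x = 0\<close> this is the identity; for \<open>x = N\<close>
    the two exchanges coincide.\<close>
  define \<pi> where "\<pi> = (\<lambda>i. if i = 0 then x else if i = x then 0 else if i = N then N - x
    else if i = N - x then N else i)"
  have "bij_betw \<pi> {..<Suc N} {..<Suc N}"
    by (rule bij_betw_byWitness[where f' = \<pi>]) (use assms in \<open>auto simp: \<pi>_def\<close>)
  then have "\<pi> permutes {..<Suc N}"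
    by (rule bij_imp_permutes) (use assms in \<open>auto simp: \<pi>_def\<close>)
  then have P: "perm_map (Suc N) \<pi> \<in> sym_autos (Suc N)"
  proof (rule perm_sym_autos[OF n], intro allI impI)
    fix p assume "p < Suc N"
    then have eqs: "N - p = 0 \<longleftrightarrow> p = N" "N - p = x \<longleftrightarrow> p = N - x" "N - p = N \<longleftrightarrow> p = 0"
      "N - p = N - x \<longleftrightarrow> p = x" "N - (N - x) = x" "N - x \<noteq> x"
      using assms(1-3) by linarith+
    consider "p = 0" | "p = N" "p \<noteq> 0" | "p = x" "p \<noteq> 0" "p \<noteq> N"
      | "p = N - x" "p \<noteq> 0" "p \<noteq> N" "p \<noteq> x" | "p \<noteq> 0" "p \<noteq> N" "p \<noteq> x" "p \<noteq> N - x" by blast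
    then have "\<pi> (N - p) = N - \<pi> p"
    proof cases
      case 1 then show ?thesis using assms(1,2) by (simp add: \<pi>_def)
    next
      case 2 then show ?thesis using assms(1,2) by (simp add: \<pi>_def)
    next
      case 3 then show ?thesis using assms(1-3) eqs(6) unfolding \<pi>_def by simp
    next
      case 4 then show ?thesis using assms(1-3) eqs(5) unfolding \<pi>_def by simp
    next
      case 5 then show ?thesis unfolding \<pi>_def eqs(1-4) by simp
    qed
    then show "\<pi> (Suc N - p - 1) = Suc N - \<pi> p - 1" by simp
  qed
  show thesis
  proof
    show "comp_lr (Suc N) (comp_lr (Suc N) Y Z) (perm_map (Suc N) \<pi>) \<in> sym_autos (Suc N)"
      using YZ P by (intro comp_lr_sym_autos)
    have "Z (Y (x, y, z)) = (x, x, x)"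
      using assms by (auto simp: Y_def Z_def cube_def)
    moreover have "\<pi> x = 0"
      by (simp add: \<pi>_def)
    moreover have "(x, y, z) \<in> cube (Suc N)" "(x, x, x) \<in> cube (Suc N)"
      using assms by (auto simp: cube_def)
    ultimately show "comp_lr (Suc N) (comp_lr (Suc N) Y Z) (perm_map (Suc N) \<pi>) (x, y, z) = (0, 0, 0)"
      by (simp add: comp_lr_def perm_map_def)
  qed
qed

section \<open>Lines joining corners\<close>

text \<open>Meant for \<open>s\<close> and \<open>t\<close> equal to 0 or \<open>N\<close>. Any two
  distinct corners span a line, and \<open>segment\<close> runs along it from the first at parameter
  0 to the second at parameter \<open>N\<close>.\<close>

definition seg_coord :: "nat \<Rightarrow> nat \<Rightarrow> nat \<Rightarrow> nat \<Rightarrow> nat" where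
  "seg_coord N s t i = (if s = t then s else if s = 0 then i else N - i)"

fun segment :: "nat \<Rightarrow> point \<Rightarrow> point \<Rightarrow> nat \<Rightarrow> point" where
  "segment N (s1, s2, s3) (t1, t2, t3) i = (seg_coord N s1 t1 i, seg_coord N s2 t2 i, seg_coord N s3 t3 i)"

fun antipode :: "nat \<Rightarrow> point \<Rightarrow> point" where
  "antipode N (x, y, z) = (N - x, N - y, N - z)"

lemma corners_iff: "(x, y, z) \<in> corners (Suc N) \<longleftrightarrow> (x = 0 \<or> x = N) \<and> (y = 0 \<or> y = N) \<and> (z = 0 \<or> z = N)"
  by (auto simp: corners_def coords_def cube_def)

lemma seg_coord_step:
  assumes "s = 0 \<or> s = N" "t = 0 \<or> t = N"
  shows "s \<noteq> t \<Longrightarrow> traverses (Suc N) (seg_coord N s t)" "s = t \<Longrightarrow> stays (Suc N) (seg_coord N s t)"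
  using assms by (auto simp: traverses_def stays_def seg_coord_def)

lemma step_eq_seg_coord:
  assumes "traverses (Suc N) f \<or> stays (Suc N) f" "i \<le> N" "j \<le> N" "k \<le> N"
    and "(i = 0 \<and> j = N) \<or> (i = N \<and> j = 0)"
  shows "f k = seg_coord N (f i) (f j) (if i = 0 then k else N - k)"
  using assms by (auto simp: traverses_def stays_def seg_coord_def less_Suc_eq_le)

text \<open>A coordinate in which two corners differ takes the values 0 and \<open>N\<close> there,
  which a traversing sequence does only at its ends. So the corners are the ends of the line and
  determine it.\<close>

lemma line_through_corners:
  assumes "1 \<le> N" "is_line (Suc N) L" "s \<in> L" "t \<in> L" "r \<in> L" "s \<noteq> t"
    and "s \<in> corners (Suc N)" "t \<in> corners (Suc N)"
  shows "\<exists>a\<le>N. r = segment N s t a"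
proof -
  obtain f g h where L: "L = line_of (Suc N) f g h"
    and fgh: "traverses (Suc N) f \<or> stays (Suc N) f" "traverses (Suc N) g \<or> stays (Suc N) g"
      "traverses (Suc N) h \<or> stays (Suc N) h"
    using assms(1,2) by (auto simp: is_line_iff)
  obtain i j k where ijk: "i \<le> N" "j \<le> N" "k \<le> N"
    and s: "s = (f i, g i, h i)" and t: "t = (f j, g j, h j)" and r: "r = (f k, g k, h k)"
    using assms(3-5) by (auto simp: L line_of_def less_Suc_eq_le)
  have ends: "(i = 0 \<and> j = N) \<or> (i = N \<and> j = 0)"
    if u: "traverses (Suc N) u \<or> stays (Suc N) u" "u i = 0 \<or> u i = N" "u j = 0 \<or> u j = N" "u i \<noteq> u j" for u
  proof -
    have "traverses (Suc N) u"
      using step_through[OF u(1) _ _ u(4)] ijk by simp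
    then have "(u i = i \<and> u j = j) \<or> (u i = N - i \<and> u j = N - j)"
      using ijk unfolding traverses_def by (metis diff_Suc_Suc less_Suc_eq_le)
    then show ?thesis
      using u(2-4) ijk by linarith
  qed
  have "f i \<noteq> f j \<or> g i \<noteq> g j \<or> h i \<noteq> h j"
    using assms(6) s t by auto
  then have "(i = 0 \<and> j = N) \<or> (i = N \<and> j = 0)"
    using ends[OF fgh(1)] ends[OF fgh(2)] ends[OF fgh(3)] assms(7,8) by (auto simp: s t corners_iff)
  then have "r = segment N s t (if i = 0 then k else N - k)"
    using step_eq_seg_coord[OF fgh(1) ijk] step_eq_seg_coord[OF fgh(2) ijk] step_eq_seg_coord[OF fgh(3) ijk]
    by (simp add: s t r)
  then show ?thesis
    using ijk(3) by (intro exI[of _ "if i = 0 then k else N - k"]) simp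
qed

lemma is_line_segment:
  assumes "1 \<le> N" "s \<in> corners (Suc N)" "t \<in> corners (Suc N)" "s \<noteq> t"
  shows "is_line (Suc N) (segment N s t ` {..N})"
proof -
  obtain s1 s2 s3 t1 t2 t3 where st: "s = (s1, s2, s3)" "t = (t1, t2, t3)"
    by (metis surj_pair)
  have "segment N s t ` {..N} = line_of (Suc N) (seg_coord N s1 t1) (seg_coord N s2 t2) (seg_coord N s3 t3)"
    by (simp add: st line_of_def lessThan_Suc_atMost)
  moreover have "s1 = 0 \<or> s1 = N" "t1 = 0 \<or> t1 = N" "s2 = 0 \<or> s2 = N" "t2 = 0 \<or> t2 = N"
    "s3 = 0 \<or> s3 = N" "t3 = 0 \<or> t3 = N" "s1 \<noteq> t1 \<or> s2 \<noteq> t2 \<or> s3 \<noteq> t3"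
    using assms(2-4) by (auto simp: st corners_iff)
  moreover have "2 \<le> Suc N" using assms(1) by simp
  ultimately show ?thesis
    unfolding is_line_iff[OF \<open>2 \<le> Suc N\<close>] using seg_coord_step[of _ N] by metis
qed

lemma segment_ends:
  assumes "s \<in> corners (Suc N)" "t \<in> corners (Suc N)"
  shows "segment N s t 0 = s" "segment N s t N = t"
  using assms by (cases s; cases t; auto simp: seg_coord_def corners_iff)+

lemma segment_eq_iff:
  assumes "s \<in> corners (Suc N)" "t \<in> corners (Suc N)" "s \<noteq> t" "i \<le> N" "j \<le> N"
  shows "segment N s t i = segment N s t j \<longleftrightarrow> i = j"
  using assms by (cases s; cases t) (auto simp: seg_coord_def corners_iff)

lemma segment_in_cube:
  assumes "s \<in> corners (Suc N)" "t \<in> corners (Suc N)" "i \<le> N"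
  shows "segment N s t i \<in> cube (Suc N)"
  using assms by (cases s; cases t) (auto simp: seg_coord_def corners_iff cube_def)

context line_automorphism
begin

text \<open>The image line contains the corners \<open>T s\<close> and \<open>T t\<close>, hence is
  their segment, and injectivity keeps interior points off its ends. Only the position
  \<open>a\<close> stays unknown.\<close>

lemma T_segment:
  assumes "s \<in> corners (Suc N)" "t \<in> corners (Suc N)" "s \<noteq> t"
    and "T s \<in> corners (Suc N)" "T t \<in> corners (Suc N)" "0 < i" "i < N"
  obtains a where "0 < a" "a < N" "T (segment N s t i) = segment N (T s) (T t) a"
proof -
  have c: "s \<in> cube (Suc N)" "t \<in> cube (Suc N)"
    using assms(1,2) by (auto simp: corners_def)
  have ne: "T s \<noteq> T t" using T_eq_iff[OF c] assms(3) by simp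
  have L: "is_line (Suc N) (T ` segment N s t ` {..N})"
    using is_line_segment[of N s t] assms(1-3) N by (intro line_autosD(4)[OF T]) simp
  have mem: "segment N s t k \<in> segment N s t ` {..N}" if "k \<le> N" for k
    using that by simp
  have "\<exists>a\<le>N. T (segment N s t i) = segment N (T s) (T t) a"
    using line_through_corners[OF _ L _ _ _ ne assms(4,5), of "T (segment N s t i)"]
      mem[of 0] mem[of N] mem[of i] segment_ends[OF assms(1,2)] N assms(7) by auto
  then obtain a where a: "a \<le> N" "T (segment N s t i) = segment N (T s) (T t) a" by blast
  have "a \<noteq> 0"
  proof
    assume "a = 0"
    then have "T (segment N s t i) = T (segment N s t 0)"
      using a segment_ends[OF assms(1,2)] segment_ends[OF assms(4,5)] by simp
    then show False
      using T_eq_iff segment_in_cube[OF assms(1,2)] segment_eq_iff[OF assms(1-3)] assms(6,7) by simp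
  qed
  moreover have "a \<noteq> N"
  proof
    assume "a = N"
    then have "T (segment N s t i) = T (segment N s t N)"
      using a segment_ends[OF assms(1,2)] segment_ends[OF assms(4,5)] by simp
    then show False
      using T_eq_iff segment_in_cube[OF assms(1,2)] segment_eq_iff[OF assms(1-3)] assms(6,7) by simp
  qed
  ultimately show thesis using that a by simp
qed

end

section \<open>Automorphisms fixing the origin\<close>

locale origin_fixing = line_automorphism +
  assumes T0: "T (0, 0, 0) = (0, 0, 0)"
begin

text \<open>Among the main diagonals only \<open>x = y = z\<close> passes through the
  origin.\<close>

lemma T_diagonal: "T ` main_diagonal N True True = main_diagonal N True True"
proof -
  obtain b c where bc: "T ` main_diagonal N True True = main_diagonal N b c"
    by (rule T_main_diagonal)
  have "(0, 0, 0) \<in> main_diagonal N True True" by (auto simp: main_diagonal_def)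
  then have "T (0, 0, 0) \<in> main_diagonal N b c"
    using bc by blast
  then have "b \<and> c"
    using T0 N by (auto simp: main_diagonal_def split: if_splits)
  then show ?thesis using bc by simp
qed

lemma T_in_diagonal_iff:
  assumes "p \<in> cube (Suc N)"
  shows "T p \<in> main_diagonal N True True \<longleftrightarrow> p \<in> main_diagonal N True True"
proof -
  have "main_diagonal N True True \<subseteq> cube (Suc N)" by (auto simp: main_diagonal_def)
  then show ?thesis
    using inj_on_image_mem_iff[OF line_autosD(2)[OF T] assms] T_diagonal by metis
qed

text \<open>Each corner is aligned with the origin, so two unequal coordinates of \<open>T p\<close>
  cannot both be nonzero. As \<open>T p\<close> lies on a main diagonal other than
  \<open>x = y = z\<close>, some coordinate is 0, and then all are 0 or \<open>N\<close>.\<close>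

lemma T_corner:
  assumes "p \<in> corners (Suc N)" "p \<notin> main_diagonal N True True"
  shows "T p \<in> corners (Suc N)" "T p \<notin> main_diagonal N True True"
proof -
  have p: "p \<in> cube (Suc N)" using assms(1) by (simp add: corners_def)
  then show nd: "T p \<notin> main_diagonal N True True"
    using assms(2) by (simp add: T_in_diagonal_iff)
  have p0: "p \<noteq> (0, 0, 0)" using assms(2) by (auto simp: main_diagonal_def)
  obtain x y z where xyz: "T p = (x, y, z)" by (metis surj_pair)
  obtain x' y' z' where xyz': "p = (x', y', z')" by (metis surj_pair)
  have "aligned (Suc N) p (0, 0, 0)" "on_main_diagonal (Suc N) p"
    using assms(1) by (auto simp: xyz' corners_iff matches_def)
  then have "aligned (Suc N) (x, y, z) (0, 0, 0)" "on_main_diagonal (Suc N) (x, y, z)"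
    using T_aligned[OF p _ p0] T_on_main_diagonal[OF p] T0 xyz by auto
  moreover have "\<not> (x = y \<and> y = z)" "x \<le> N" "y \<le> N" "z \<le> N"
    using nd T_in_cube[OF p] by (auto simp: xyz main_diagonal_def)
  ultimately show "T p \<in> corners (Suc N)"
    using N by (auto simp: xyz corners_iff matches_def)
qed

text \<open>A corner and its antipode share a main diagonal, and the only corners on the image
  diagonal are its two ends.\<close>

lemma T_antipode:
  assumes "p \<in> corners (Suc N)" "p \<notin> main_diagonal N True True"
  shows "T (antipode N p) = antipode N (T p)"
proof -
  obtain x y z where xyz: "p = (x, y, z)" by (metis surj_pair)
  define b c where "b \<longleftrightarrow> y = x" and "c \<longleftrightarrow> z = x"
  have q: "antipode N p \<in> corners (Suc N)" "antipode N p \<notin> main_diagonal N True True" "antipode N p \<noteq> p"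
    using assms N by (auto simp: xyz corners_iff main_diagonal_def)
  have "p \<in> main_diagonal N b c" "antipode N p \<in> main_diagonal N b c"
    using assms by (auto simp: xyz b_def c_def corners_iff main_diagonal_def)
  moreover obtain b' c' where "T ` main_diagonal N b c = main_diagonal N b' c'"
    by (rule T_main_diagonal)
  ultimately have "T p \<in> main_diagonal N b' c'" "T (antipode N p) \<in> main_diagonal N b' c'"
    by blast+
  then obtain i j where ij: "T p = (i, if b' then i else N - i, if c' then i else N - i)"
     "T (antipode N p) = (j, if b' then j else N - j, if c' then j else N - j)"
    by (auto simp: main_diagonal_def)
  moreover have "i = 0 \<or> i = N" "j = 0 \<or> j = N"
    using T_corner(1)[OF assms] T_corner(1)[OF q(1,2)] by (auto simp: ij corners_iff)
  moreover have "T p \<noteq> T (antipode N p)"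
    using T_eq_iff assms(1) q(1,3) by (auto simp: corners_def)
  ultimately show ?thesis by auto
qed

text \<open>The image is some \<open>(j, j, j)\<close> aligned with the corner
  \<open>T (N, 0, 0)\<close>, which has both 0 and \<open>N\<close> among its coordinates. This
  leaves \<open>j = 0\<close>, \<open>j = N\<close> or the centre, and injectivity rules out the
  first and the last.\<close>

lemma T_far_corner: "T (N, N, N) = (N, N, N)"
proof -
  have "T (N, N, N) \<in> main_diagonal N True True"
    by (subst T_in_diagonal_iff) (auto simp: main_diagonal_def)
  then obtain j where j: "T (N, N, N) = (j, j, j)" "j \<le> N"
    by (auto simp: main_diagonal_def)
  have "j \<noteq> 0"
    using T_eq_iff[of "(N, N, N)" "(0, 0, 0)"] T0 j N by auto
  have "2 * j \<noteq> N"
    using T_center[of j] T_eq_iff[of "(N, N, N)" "(j, j, j)"] j N by auto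
  obtain x y z where xyz: "T (N, 0, 0) = (x, y, z)" by (metis surj_pair)
  have "(x, y, z) \<in> corners (Suc N)" "(x, y, z) \<notin> main_diagonal N True True"
    using T_corner[of "(N, 0, 0)"] N xyz by (auto simp: corners_iff main_diagonal_def)
  moreover have "aligned (Suc N) (j, j, j) (x, y, z)"
    using T_aligned[of "(N, N, N)" "(N, 0, 0)"] N xyz j by (auto simp: matches_def)
  ultimately show ?thesis
    using \<open>j \<noteq> 0\<close> \<open>2 * j \<noteq> N\<close> j N by (auto simp: corners_iff main_diagonal_def matches_def)
qed

end

section \<open>The three corners next to the origin\<close>

definition axis_orders :: "nat \<Rightarrow> (point \<times> point \<times> point) set" where
  "axis_orders N = {((N, 0, 0), (0, N, 0), (0, 0, N)), ((N, 0, 0), (0, 0, N), (0, N, 0)),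
    ((0, N, 0), (N, 0, 0), (0, 0, N)), ((0, N, 0), (0, 0, N), (N, 0, 0)),
    ((0, 0, N), (N, 0, 0), (0, N, 0)), ((0, 0, N), (0, N, 0), (N, 0, 0))}"

text \<open>Call a corner near or far if one or two of its coordinates are \<open>N\<close>;
  antipodes are of opposite kinds. Interior points of segments from the origin to two different such
  corners are aligned only if one corner is near and the other far. So the first two alignments make
  \<open>p1\<close>, \<open>p2\<close>, \<open>p3\<close> all near or all far, and the third
  excludes all far.\<close>

lemma axis_corners_cases:
  assumes N: "2 \<le> N"
    and p: "p1 \<in> corners (Suc N) - main_diagonal N True True" "p2 \<in> corners (Suc N) - main_diagonal N True True"
      "p3 \<in> corners (Suc N) - main_diagonal N True True"
    and ne: "p1 \<noteq> p2" "p1 \<noteq> p3" "p2 \<noteq> p3" "p1 \<noteq> antipode N p2" "p1 \<noteq> antipode N p3" "p2 \<noteq> antipode N p3"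
    and ab: "0 < a1" "a1 < N" "0 < a2" "a2 < N" "0 < b1" "b1 < N" "0 < b3" "b3 < N" "0 < c" "c < N"
    and al: "aligned (Suc N) (segment N (0, 0, 0) p1 a1) (segment N (0, 0, 0) (antipode N p3) b3)"
      "aligned (Suc N) (segment N (0, 0, 0) p2 a2) (segment N (0, 0, 0) (antipode N p1) b1)"
      "aligned (Suc N) (segment N (0, 0, 0) p1 a1) (segment N p2 (antipode N p3) c)"
  shows "(p1, p2, p3) \<in> axis_orders N"
proof -
  have six: "p \<in> {(N, 0, 0), (0, N, 0), (0, 0, N), (0, N, N), (N, 0, N), (N, N, 0)}"
    if "p \<in> corners (Suc N) - main_diagonal N True True" for p
    using that by (cases p) (auto simp: corners_iff main_diagonal_def)
  \<comment> \<open>Inequalities in both orientations, to serve as rewrite rules deciding the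
    equations of the case check. The simp rules on zero differences are switched off there so that
    the entries about \<open>N - c\<close> apply literally.\<close>
  have N0: "N \<noteq> 0" "0 \<noteq> N" "a1 \<noteq> 0" "0 \<noteq> a1" "a1 \<noteq> N" "N \<noteq> a1" "a2 \<noteq> 0" "0 \<noteq> a2" "a2 \<noteq> N" "N \<noteq> a2"
     "b1 \<noteq> 0" "0 \<noteq> b1" "b1 \<noteq> N" "N \<noteq> b1" "b3 \<noteq> 0" "0 \<noteq> b3" "b3 \<noteq> N" "N \<noteq> b3"
     "c \<noteq> 0" "0 \<noteq> c" "c \<noteq> N" "N \<noteq> c" "N - c \<noteq> 0" "0 \<noteq> N - c" "N - c \<noteq> N" "N \<noteq> N - c"
    using N ab by linarith+
  show ?thesis
    \<comment> \<open>All triples of the six corners are checked.\<close>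
    using six[OF p(1)] six[OF p(2)] six[OF p(3)] ne al
    unfolding axis_orders_def insert_iff empty_iff simp_thms
    by (elim disjE; hypsubst)
      (simp_all add: N0 seg_coord_def matches_def del: diff_is_0_eq diff_is_0_eq' zero_less_diff)
qed

text \<open>The swaps of adjacent coordinates generate all coordinate permutations; the identity
  appears as a swap done twice.\<close>

lemma exists_sym_auto_axes:
  assumes "1 \<le> N"
    and "(p1, p2, p3) \<in> axis_orders N"
  shows "\<exists>A\<in>sym_autos (Suc N). A (0, 0, 0) = (0, 0, 0) \<and> A p1 = (N, 0, 0) \<and> A p2 = (0, N, 0) \<and> A p3 = (0, 0, N)"
proof -
  have n: "2 \<le> Suc N" using assms(1) by simp
  define X Y where "X = swap_xy (Suc N)" and "Y = swap_yz (Suc N)"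
  have XY: "X \<in> sym_autos (Suc N)" "Y \<in> sym_autos (Suc N)"
    using swap_sym_autos[OF n] by (simp_all add: X_def Y_def)
  have eq: "X (x, y, z) = (y, x, z)" "Y (x, y, z) = (x, z, y)" "comp_lr (Suc N) A B (x, y, z) = B (A (x, y, z))"
    if "x = 0 \<or> x = N" "y = 0 \<or> y = N" "z = 0 \<or> z = N" for x y z A B
    using that by (auto simp: X_def Y_def comp_lr_def cube_def)
  let ?c = "comp_lr (Suc N)"
  have mem: "?c X X \<in> sym_autos (Suc N)" "?c X Y \<in> sym_autos (Suc N)" "?c Y X \<in> sym_autos (Suc N)"
    "?c (?c X Y) X \<in> sym_autos (Suc N)"
    using XY by (simp_all add: comp_lr_sym_autos)
  consider "p1 = (N, 0, 0)" "p2 = (0, N, 0)" "p3 = (0, 0, N)" | "p1 = (N, 0, 0)" "p2 = (0, 0, N)" "p3 = (0, N, 0)"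
    | "p1 = (0, N, 0)" "p2 = (N, 0, 0)" "p3 = (0, 0, N)" | "p1 = (0, N, 0)" "p2 = (0, 0, N)" "p3 = (N, 0, 0)"
    | "p1 = (0, 0, N)" "p2 = (N, 0, 0)" "p3 = (0, N, 0)" | "p1 = (0, 0, N)" "p2 = (0, N, 0)" "p3 = (N, 0, 0)"
    using assms(2) by (auto simp: axis_orders_def)
  then show ?thesis
  proof cases
    case 1 with mem(1) show ?thesis by (intro bexI[of _ "?c X X"]) (simp_all add: eq)
  next
    case 2 with XY show ?thesis by (intro bexI[of _ Y]) (simp_all add: eq)
  next
    case 3 with XY show ?thesis by (intro bexI[of _ X]) (simp_all add: eq)
  next
    case 4 with mem(2) show ?thesis by (intro bexI[of _ "?c X Y"]) (simp_all add: eq)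
  next
    case 5 with mem(3) show ?thesis by (intro bexI[of _ "?c Y X"]) (simp_all add: eq)
  next
    case 6 with mem(4) show ?thesis by (intro bexI[of _ "?c (?c X Y) X"]) (simp_all add: eq)
  qed
qed

context origin_fixing
begin

lemma T_axis_corners:
  "(T (N, 0, 0), T (0, N, 0), T (0, 0, N)) \<in> axis_orders N"
proof -
  have c: "(N, 0, 0) \<in> corners (Suc N)" "(0, N, 0) \<in> corners (Suc N)" "(0, 0, N) \<in> corners (Suc N)"
    "(0, 0, 0) \<in> corners (Suc N)" "(N, N, 0) \<in> corners (Suc N)" "(0, N, N) \<in> corners (Suc N)"
    by (auto simp: corners_iff)
  have d: "(N, 0, 0) \<notin> main_diagonal N True True" "(0, N, 0) \<notin> main_diagonal N True True"
    "(0, 0, N) \<notin> main_diagonal N True True" "(N, N, 0) \<notin> main_diagonal N True True"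
    "(0, N, N) \<notin> main_diagonal N True True"
    using N by (auto simp: main_diagonal_def)
  note Tc = T_corner(1)[OF c(1) d(1)] T_corner(1)[OF c(2) d(2)] T_corner(1)[OF c(3) d(3)]
  note Td = T_corner(2)[OF c(1) d(1)] T_corner(2)[OF c(2) d(2)] T_corner(2)[OF c(3) d(3)]
  have T0c: "T (0, 0, 0) \<in> corners (Suc N)"
    using T0 by (simp add: corners_iff)
  have anti: "T (0, N, N) = antipode N (T (N, 0, 0))" "T (N, 0, N) = antipode N (T (0, N, 0))"
    "T (N, N, 0) = antipode N (T (0, 0, N))"
    using T_antipode[OF c(1) d(1)] T_antipode[OF c(2) d(2)] T_antipode[OF c(3) d(3)] by simp_all
  note Tc' = T_corner(1)[OF c(5) d(4)] T_corner(1)[OF c(6) d(5)]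
  have i: "0 < (1::nat)" "1 < N" "N \<noteq> 0" using N by auto
  \<comment> \<open>Parameter 1 is interior because \<open>2 \<le> N\<close>. The images of five
    points at parameter 1 on segments between corners are known up to their positions
    \<open>a1\<close>, \<open>a2\<close>, \<open>b3\<close>, \<open>b1\<close>,
    \<open>e\<close>.\<close>
  obtain a1 where a1: "0 < a1" "a1 < N" "T (1, 0, 0) = segment N (0, 0, 0) (T (N, 0, 0)) a1"
    using T_segment[OF c(4) c(1) _ T0c Tc(1) i(1,2)] i(3) unfolding T0 by (auto simp: seg_coord_def)
  obtain a2 where a2: "0 < a2" "a2 < N" "T (0, 1, 0) = segment N (0, 0, 0) (T (0, N, 0)) a2"
    using T_segment[OF c(4) c(2) _ T0c Tc(2) i(1,2)] i(3) unfolding T0 by (auto simp: seg_coord_def)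
  obtain b3 where b3: "0 < b3" "b3 < N" "T (1, 1, 0) = segment N (0, 0, 0) (antipode N (T (0, 0, N))) b3"
    using T_segment[OF c(4) c(5) _ T0c Tc'(1) i(1,2)] i(3) unfolding T0 anti by (auto simp: seg_coord_def)
  obtain b1 where b1: "0 < b1" "b1 < N" "T (0, 1, 1) = segment N (0, 0, 0) (antipode N (T (N, 0, 0))) b1"
    using T_segment[OF c(4) c(6) _ T0c Tc'(2) i(1,2)] i(3) unfolding T0 anti by (auto simp: seg_coord_def)
  obtain e where e: "0 < e" "e < N" "T (1, N, 0) = segment N (T (0, N, 0)) (antipode N (T (0, 0, N))) e"
    using T_segment[OF c(2) c(5) _ Tc(2) Tc'(1) i(1,2)] i(3) unfolding anti by (auto simp: seg_coord_def)
  show ?thesis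
  proof (rule axis_corners_cases[OF N])
    show "T (N, 0, 0) \<in> corners (Suc N) - main_diagonal N True True"
      "T (0, N, 0) \<in> corners (Suc N) - main_diagonal N True True"
      "T (0, 0, N) \<in> corners (Suc N) - main_diagonal N True True"
      using Tc Td by simp_all
    show "T (N, 0, 0) \<noteq> T (0, N, 0)" "T (N, 0, 0) \<noteq> T (0, 0, N)" "T (0, N, 0) \<noteq> T (0, 0, N)"
      "T (N, 0, 0) \<noteq> antipode N (T (0, N, 0))" "T (N, 0, 0) \<noteq> antipode N (T (0, 0, N))"
      "T (0, N, 0) \<noteq> antipode N (T (0, 0, N))"
      unfolding anti[symmetric] using i by (simp_all add: T_eq_iff)
    \<comment> \<open>The three alignments are images of pairs on axis-parallel lines:
      \<open>(1, 0, 0)\<close> with \<open>(1, 1, 0)\<close>, \<open>(0, 1, 0)\<close> with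
      \<open>(0, 1, 1)\<close>, and \<open>(1, 0, 0)\<close> with \<open>(1, N, 0)\<close>.\<close>
    show "aligned (Suc N) (segment N (0, 0, 0) (T (N, 0, 0)) a1) (segment N (0, 0, 0) (antipode N (T (0, 0, N))) b3)"
      unfolding a1(3)[symmetric] b3(3)[symmetric] by (rule T_aligned) (use N in \<open>auto simp: matches_def\<close>)
    show "aligned (Suc N) (segment N (0, 0, 0) (T (0, N, 0)) a2) (segment N (0, 0, 0) (antipode N (T (N, 0, 0))) b1)"
      unfolding a2(3)[symmetric] b1(3)[symmetric] by (rule T_aligned) (use N in \<open>auto simp: matches_def\<close>)
    show "aligned (Suc N) (segment N (0, 0, 0) (T (N, 0, 0)) a1) (segment N (T (0, N, 0)) (antipode N (T (0, 0, N))) e)"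
      unfolding a1(3)[symmetric] e(3)[symmetric] by (rule T_aligned) (use N in \<open>auto simp: matches_def\<close>)
  qed (use a1 a2 b1 b3 e in simp_all)
qed

lemma T_corners_fixed:
  assumes "T (N, 0, 0) = (N, 0, 0)" "T (0, N, 0) = (0, N, 0)" "T (0, 0, N) = (0, 0, N)" "p \<in> corners (Suc N)"
  shows "T p = p"
proof -
  have c: "(N, 0, 0) \<in> corners (Suc N)" "(0, N, 0) \<in> corners (Suc N)" "(0, 0, N) \<in> corners (Suc N)"
    by (auto simp: corners_iff)
  have d: "(N, 0, 0) \<notin> main_diagonal N True True" "(0, N, 0) \<notin> main_diagonal N True True"
    "(0, 0, N) \<notin> main_diagonal N True True"
    using N by (auto simp: main_diagonal_def)
  have "T (0, N, N) = (0, N, N)" "T (N, 0, N) = (N, 0, N)" "T (N, N, 0) = (N, N, 0)"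
    using T_antipode[OF c(1) d(1)] T_antipode[OF c(2) d(2)] T_antipode[OF c(3) d(3)] assms(1-3) by simp_all
  then show ?thesis
    using assms T0 T_far_corner by (cases p) (auto simp: corners_iff)
qed

end

section \<open>The permutation induced on an edge\<close>

lemma comp_lr_apply: "p \<in> cube n \<Longrightarrow> comp_lr n T A p = A (T p)"
  by (simp add: comp_lr_def)

lemma symmetric_perm_inv:
  assumes "\<pi> permutes {..<n}" "\<forall>p<n. \<pi> (n - p - 1) = n - \<pi> p - 1"
  shows "\<forall>p<n. inv_into UNIV \<pi> (n - p - 1) = n - inv_into UNIV \<pi> p - 1"
proof (intro allI impI)
  fix p assume "p < n"
  then have "inv_into UNIV \<pi> p < n"
    using permutes_in_image[OF permutes_inv[OF assms(1)], of p] by simp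
  then have "\<pi> (n - inv_into UNIV \<pi> p - 1) = n - p - 1"
    using assms(2) permutes_inverses(1)[OF assms(1)] by simp
  then show "inv_into UNIV \<pi> (n - p - 1) = n - inv_into UNIV \<pi> p - 1"
    using permutes_inverses(2)[OF assms(1)] by metis
qed

context line_automorphism
begin

text \<open>Once the corners are fixed, every segment between corners is mapped to itself. The
  points \<open>(i, 0, 0)\<close>, \<open>(i, i, i)\<close>, \<open>(i, N - i, N - i)\<close>,
  \<open>(i, N, N)\<close> share the diagonal \<open>y = z\<close> of the plane
  \<open>x = i\<close>, which ties their images to the single value \<open>\<pi> i\<close>.\<close>

lemma fixed_corners_edge_perm:
  assumes fix_corners: "\<And>p. p \<in> corners (Suc N) \<Longrightarrow> T p = p"
  obtains \<pi> where "\<pi> permutes {..<Suc N}" "\<forall>p<Suc N. \<pi> (Suc N - p - 1) = Suc N - \<pi> p - 1"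
    "\<And>i. i \<le> N \<Longrightarrow> T (i, 0, 0) = (\<pi> i, 0, 0)" "\<pi> 0 = 0" "\<pi> N = N"
proof -
  define \<pi> where "\<pi> = (\<lambda>i. if i \<le> N then fst (T (i, 0, 0)) else i)"
  have c: "(x, y, z) \<in> corners (Suc N) \<and> T (x, y, z) = (x, y, z)"
    if "x = 0 \<or> x = N" "y = 0 \<or> y = N" "z = 0 \<or> z = N" for x y z
    using that fix_corners by (auto simp: corners_iff)
  have seg: "\<exists>a>0. a < N \<and> T (segment N s t i) = segment N s t a"
    if "s \<in> corners (Suc N)" "t \<in> corners (Suc N)" "s \<noteq> t" "0 < i" "i < N" for s t i
    using T_segment[OF that(1-3) _ _ that(4,5)] that(1,2) fix_corners by metis
  have ends: "\<pi> 0 = 0" "\<pi> N = N"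
    using c[of 0 0 0] c[of N 0 0] by (simp_all add: \<pi>_def)
  have inner: "0 < \<pi> i" "\<pi> i < N" "T (i, 0, 0) = (\<pi> i, 0, 0)" if "0 < i" "i < N" for i
    using seg[of "(0, 0, 0)" "(N, 0, 0)" i] c[of 0 0 0] c[of N 0 0] that by (auto simp: \<pi>_def seg_coord_def)
  have axis: "T (i, 0, 0) = (\<pi> i, 0, 0)" if "i \<le> N" for i
    using inner(3)[of i] c[of 0 0 0] c[of N 0 0] ends that
    by (cases "i = 0"; cases "i = N") auto
  have inj: "\<pi> i = \<pi> j \<longleftrightarrow> i = j" if "i \<le> N" "j \<le> N" for i j
    using T_eq_iff[of "(i, 0, 0)" "(j, 0, 0)"] axis that by auto
  have le: "\<pi> i \<le> N" if "i \<le> N" for i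
    using T_in_cube[of "(i, 0, 0)"] axis[OF that] that by simp
  have opposite: "T (i, N, N) = (\<pi> i, N, N)" if i: "0 < i" "i < N" for i
  proof -
    obtain a where a: "0 < a" "a < N" "T (i, N, N) = (a, N, N)"
      using seg[of "(0, N, N)" "(N, N, N)" i] c[of 0 N N] c[of N N N] i by (auto simp: seg_coord_def)
    have "aligned (Suc N) (T (i, 0, 0)) (T (i, N, N))"
      by (rule T_aligned) (use i in \<open>auto simp: matches_def\<close>)
    then show ?thesis
      using a inner[OF i] by (auto simp: matches_def)
  qed
  have main: "T (i, i, i) = (\<pi> i, \<pi> i, \<pi> i)" if i: "0 < i" "i < N" for i
  proof -
    obtain a where a: "0 < a" "a < N" "T (i, i, i) = (a, a, a)"
      using seg[of "(0, 0, 0)" "(N, N, N)" i] c[of 0 0 0] c[of N N N] i by (auto simp: seg_coord_def)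
    have "aligned (Suc N) (T (i, 0, 0)) (T (i, i, i))"
      by (rule T_aligned) (use i in \<open>auto simp: matches_def\<close>)
    then show ?thesis
      using a inner[OF i] by (auto simp: matches_def)
  qed
  have anti: "T (i, N - i, N - i) = (\<pi> i, N - \<pi> i, N - \<pi> i)" if i: "0 < i" "i < N" for i
  proof -
    obtain a where a: "0 < a" "a < N" "T (i, N - i, N - i) = (a, N - a, N - a)"
      using seg[of "(0, N, N)" "(N, 0, 0)" i] c[of 0 N N] c[of N 0 0] i by (auto simp: seg_coord_def)
    have "aligned (Suc N) (T (i, N, N)) (T (i, N - i, N - i))"
      by (rule T_aligned) (use i in \<open>auto simp: matches_def\<close>)
    then show ?thesis
      using a inner[OF i] opposite[OF i] by (auto simp: matches_def)
  qed
  \<comment> \<open>The centre is its own image, so no other diagonal point is sent there.\<close>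
  have center: "2 * i = N" if i: "0 < i" "i < N" "2 * \<pi> i = N" for i
    using T_center[OF i(3)] main[OF i(1,2)] T_eq_iff[of "(i, i, i)" "(\<pi> i, \<pi> i, \<pi> i)"] i by auto
  have sym: "\<pi> (N - i) = N - \<pi> i" if "i \<le> N" for i
  proof (cases "i = 0 \<or> i = N")
    case True
    then show ?thesis using ends by auto
  next
    case False
    with that have i: "0 < i" "i < N" by auto
    then have j: "0 < N - i" "N - i < N" by auto
    show ?thesis
    proof (cases "2 * i = N")
      case True
      then have "N - i = i" by simp
      then show ?thesis using main[OF i] anti[OF i] by simp
    next
      case False
      have ne: "\<pi> (N - i) \<noteq> \<pi> i" using inj[of "N - i" i] i False by auto
      have nc: "2 * \<pi> i \<noteq> N" "2 * \<pi> (N - i) \<noteq> N"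
        using center[OF i] center[OF j] False i by auto
      \<comment> \<open>The two points lie on a line parallel to the first axis. Their images differ
        in the first coordinate, so either the second coordinates agree, which is the claim, or
        \<open>\<pi> i\<close> or \<open>\<pi> (N - i)\<close> is central.\<close>
      have "aligned (Suc N) (T (N - i, N - i, N - i)) (T (i, N - i, N - i))"
        by (rule T_aligned) (use i False in \<open>auto simp: matches_def\<close>)
      then show ?thesis
        using inner(1,2)[OF i] inner(1,2)[OF j] ne nc unfolding main[OF j] anti[OF i]
        by (auto simp: matches_def)
    qed
  qed
  have "inj_on \<pi> {..<Suc N}" "\<pi> ` {..<Suc N} \<subseteq> {..<Suc N}"
    using inj le by (auto simp: inj_on_def less_Suc_eq_le)
  then have "bij_betw \<pi> {..<Suc N} {..<Suc N}"
    by (simp add: bij_betw_def endo_inj_surj)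
  then have "\<pi> permutes {..<Suc N}"
    by (rule bij_imp_permutes) (simp add: \<pi>_def)
  then show thesis
    using that sym axis ends by simp
qed

lemma fixed_corners_normalizable:
  assumes fix_corners: "\<And>p. p \<in> corners (Suc N) \<Longrightarrow> T p = p"
  shows "normalizable (Suc N) T"
proof -
  obtain \<pi> where \<pi>: "\<pi> permutes {..<Suc N}" "\<forall>p<Suc N. \<pi> (Suc N - p - 1) = Suc N - \<pi> p - 1"
    and axis: "\<And>i. i \<le> N \<Longrightarrow> T (i, 0, 0) = (\<pi> i, 0, 0)" and ends: "\<pi> 0 = 0" "\<pi> N = N"
    using fixed_corners_edge_perm[OF fix_corners] by metis
  \<comment> \<open>Undoes \<open>\<pi>\<close> along the edge; it moves no corner because
    \<open>\<pi>\<close> fixes 0 and \<open>N\<close>.\<close>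
  let ?A = "perm_map (Suc N) (inv_into UNIV \<pi>)"
  have inv: "inv_into UNIV \<pi> (\<pi> i) = i" for i
    by (rule permutes_inverses(2)[OF \<pi>(1)])
  have inv_ends: "inv_into UNIV \<pi> 0 = 0" "inv_into UNIV \<pi> N = N"
    using inv[of 0] inv[of N] ends by simp_all
  have le: "\<pi> i \<le> N" if "i \<le> N" for i
    using permutes_in_image[OF \<pi>(1), of i] that by simp
  have "?A \<in> std_autos (Suc N)"
    using perm_sym_autos[OF _ permutes_inv[OF \<pi>(1)] symmetric_perm_inv[OF \<pi>]] N by (simp add: sym_autos_def)
  moreover have "comp_lr (Suc N) T ?A p = p" if "p \<in> corners (Suc N)" for p
    using that fix_corners[OF that] inv_ends
    by (cases p) (auto simp: comp_lr_def perm_map_def corners_iff)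
  moreover have "comp_lr (Suc N) T ?A (i, 0, 0) = (i, 0, 0)" if "i \<le> N" for i
    using that axis le inv inv_ends by (simp add: comp_lr_def perm_map_def)
  ultimately show ?thesis
    unfolding normalizable_def by (intro bexI[of _ ?A]) (auto simp: less_Suc_eq_le)
qed

end

section \<open>Assembling the normalisation\<close>

lemma (in origin_fixing) origin_fixing_normalizable: "normalizable (Suc N) T"
proof -
  obtain A where A: "A \<in> sym_autos (Suc N)" "A (0, 0, 0) = (0, 0, 0)"
    "A (T (N, 0, 0)) = (N, 0, 0)" "A (T (0, N, 0)) = (0, N, 0)" "A (T (0, 0, N)) = (0, 0, N)"
    using exists_sym_auto_axes[OF _ T_axis_corners] N by auto
  \<comment> \<open>The adjusted map again fixes the origin, so the results for such automorphisms
    apply to it in place of \<open>T\<close>.\<close>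
  interpret TA: origin_fixing N "comp_lr (Suc N) T A"
    using N T A T0 by unfold_locales (simp_all add: sym_autos_def comp_lr_line_autos comp_lr_apply)
  have "normalizable (Suc N) (comp_lr (Suc N) T A)"
    using TA.fixed_corners_normalizable TA.T_corners_fixed A(3-5) by (simp add: comp_lr_apply)
  then show ?thesis
    by (rule normalizable_comp_lr[OF T A(1)])
qed

lemma (in line_automorphism) line_automorphism_normalizable: "normalizable (Suc N) T"
proof -
  obtain x y z where "T (0, 0, 0) = (x, y, z)" "x \<le> N" "2 * x \<noteq> N"
    "y = x \<or> y = N - x" "z = x \<or> z = N - x"
    by (rule T_origin)
  \<comment> \<open>The condition \<open>2 * x \<noteq> N\<close> on the image of the origin is what
    makes this adjustment available.\<close>
  moreover from this(2-) N obtain A where A: "A \<in> sym_autos (Suc N)" "A (x, y, z) = (0, 0, 0)"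
    using exists_sym_auto_to_origin[of N x y z] by auto
  ultimately interpret TA: origin_fixing N "comp_lr (Suc N) T A"
    using N T by unfold_locales (simp_all add: sym_autos_def comp_lr_line_autos comp_lr_apply)
  show ?thesis
    using TA.origin_fixing_normalizable by (rule normalizable_comp_lr[OF T A(1)])
qed

theorem theorem3:
  fixes n :: nat and T :: "point \<Rightarrow> point"
  assumes "n \<ge> 3" and "T \<in> line_autos n"
  shows "\<exists>A\<in>std_autos n.
           (\<forall>p\<in>corners n. comp_lr n T A p = p) \<and>
           (\<forall>p\<in>{(i, 0, 0) | i. i < n}. comp_lr n T A p = p)"
proof -
  obtain N where n: "n = Suc N"
    using assms(1) by (cases n) auto
  interpret line_automorphism N T
    using assms by unfold_locales (simp_all add: n)
  show ?thesis
    using line_automorphism_normalizable unfolding n normalizable_def .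
qed

end
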